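(* Consider an asymptotic regime indexed by $n\to\infty$ with $p=p_n>n$, and the linear model $Y=X\beta_0+\epsilon$, where $X=(X_1,\dots,X_p)\in\mathbb{R}^{n\times p}$ is a random design with zero mean and positive definite $\Sigma=E[X^TX/n]$, $\beta_0\in\mathbb{R}^p$ has $s_0$ nonzero entries, and $\epsilon\sim N(0,\sigma_\epsilon^2I_n)$ is independent of $X$. Assume: (A1) (general position) with probability one, for any $k<\min\{n,p\}$, any indices $i_1,\dots,i_{k+1}$ and signs $\sigma_1,\dots,\sigma_{k+1}\in\{-1,1\}$, the affine span of $\sigma_1X_{i_1},\dots,\sigma_{k+1}X_{i_{k+1}}$ contains no element of $\{\pm X_i:i\ne i_1,\dots,i_{k+1}\}$; (A2) there are positive constants $C_{\min}$, $K$ (with $n$ divisible by $K$) such that $P(\phi_{\min}(n/K)\ge C_{\min})\to1$; (A3) there is a positive constant $C_{\max}$ with $P(\phi_{\max}(n)\le C_{\max})\to1$; (A4) (i) there is a positive constant $C^*$ with $P(\phi_{\max}(1)>C^* )=O(1/p)$; (ii) there is a positive constant $\kappa_{\min}$ with $P(\kappa(s_0,3)^2\ge\kappa_{\min}^2)\to1$. Suppose $s_0=o(\sqrt{n/\log p})$. Then for suitably selected $\lambda_0\asymp\sqrt{\log p/n}$ and $\lambda_1\asymp1/\sqrt n$, $$\sqrt n(\hat b_1-\beta_{01})=W_1+\Delta_1,$$ where $W_1=\frac1{\sqrt n}\hat\Theta_1^TX^T\epsilon$ satisfies $W_1\mid X\sim N(0,\sigma_\epsilon^2\hat\Omega_{1,1})$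 with $\hat\Omega_{1,1}:=\hat\Theta_1^T\hat\Sigma\hat\Theta_1=O_P(1)$, and $\Delta_1:=\sqrt n(\hat\Sigma\hat\Theta_1-e_1)^T(\beta_0-\hat\beta)=o_P(1)$.
   Context: $\hat\Sigma=X^TX/n$; $e_1$ is the first standard basis vector; $\beta_{01}$ is the first entry of $\beta_0$. $a_n\asymp b_n$ means $C_1\le a_n/b_n\le C_2$ for positive constants $C_1,C_2$. Restricted eigenvalues: $\phi_{\max}(s)=\max_{1\le\|z\|_0\le s}\frac{\|Xz\|^2}{n\|z\|^2}$, $\phi_{\min}(s)=\min_{1\le\|z\|_0\le s}\frac{\|Xz\|^2}{n\|z\|^2}$, and $\kappa(s,c_0)^2=\min_{S\subset\{1,\dots,p\},|S|\le s}\ \min_{z\ne0,\ \|z_{S^c}\|_1\le c_0\|z_S\|_1}\frac{\|Xz\|^2}{n\|z_S\|^2}$. Lasso: $\hat\beta=\arg\min_\beta\frac1n\|Y-X\beta\|^2+2\lambda_0\|\beta\|_1$. Node-wise Lasso: $\hat\gamma_1=\arg\min_{\gamma\in\mathbb{R}^{p-1}}\frac1n\|X_1-X_{-1}\gamma\|^2+2\lambda_1\|\gamma\|_1$ ($X_{-1}$ is $X$ without its first column), $\tilde\tau_1^2=\frac1n\|X_1-X_{-1}\hat\gamma_1\|^2$, $\hat\tau_1^2=\tilde\tau_1^2+\lambda_1\|\hat\gamma_1\|_1$, $\hat\Theta_1=\hat\tau_1^{-2}(1,-\hat\gamma_1^T)^T$. Debiased Lasso: $\hat b_1=\hat\beta_1+\frac1n\hat\Theta_1^TX^T(Y-X\hat\beta)$.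 *)

theory Defs
  imports "HOL-Probability.Probability" "HOL-Library.Landau_Symbols"
begin

text \<open>Conventions. A vector in R^p is a function nat => real vanishing at indices >= p;
an n x p matrix is a function nat => nat => real (row i < n, column j < p).
Indices start at 0, so the paper's first column / first coordinate is index 0.\<close>

definition mv :: "nat \<Rightarrow> (nat \<Rightarrow> nat \<Rightarrow> real) \<Rightarrow> (nat \<Rightarrow> real) \<Rightarrow> nat \<Rightarrow> real" where
  "mv p X z = (\<lambda>i. \<Sum>j<p. X i j * z j)"

definition sqn :: "nat \<Rightarrow> (nat \<Rightarrow> real) \<Rightarrow> real" where
  "sqn n v = (\<Sum>i<n. (v i)^2)"

definition l0norm :: "nat \<Rightarrow> (nat \<Rightarrow> real) \<Rightarrow> nat" where
  "l0norm p z = card {j. j < p \<and> z j \<noteq> 0}"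

definition phi_max :: "nat \<Rightarrow> nat \<Rightarrow> (nat \<Rightarrow> nat \<Rightarrow> real) \<Rightarrow> nat \<Rightarrow> real" where
  "phi_max n p X s = Sup {sqn n (mv p X z) / (real n * (\<Sum>j<p. (z j)^2)) | z.
      (\<forall>j\<ge>p. z j = 0) \<and> 1 \<le> l0norm p z \<and> l0norm p z \<le> s}"

definition phi_min :: "nat \<Rightarrow> nat \<Rightarrow> (nat \<Rightarrow> nat \<Rightarrow> real) \<Rightarrow> nat \<Rightarrow> real" where
  "phi_min n p X s = Inf {sqn n (mv p X z) / (real n * (\<Sum>j<p. (z j)^2)) | z.
      (\<forall>j\<ge>p. z j = 0) \<and> 1 \<le> l0norm p z \<and> l0norm p z \<le> s}"

definition kappa_sq :: "nat \<Rightarrow> nat \<Rightarrow> (nat \<Rightarrow> nat \<Rightarrow> real) \<Rightarrow> nat \<Rightarrow> real \<Rightarrow> real" where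
  "kappa_sq n p X s c0 = Inf {sqn n (mv p X z) / (real n * (\<Sum>j\<in>S. (z j)^2)) | S z.
      S \<subseteq> {..<p} \<and> card S \<le> s \<and> (\<forall>j\<ge>p. z j = 0) \<and> (\<exists>j<p. z j \<noteq> 0) \<and>
      (\<Sum>j\<in>{..<p} - S. \<bar>z j\<bar>) \<le> c0 * (\<Sum>j\<in>S. \<bar>z j\<bar>)}"

definition general_position :: "nat \<Rightarrow> nat \<Rightarrow> (nat \<Rightarrow> nat \<Rightarrow> real) \<Rightarrow> bool" where
  "general_position n p X \<longleftrightarrow>
     (\<forall>S sg. S \<subseteq> {..<p} \<and> 1 \<le> card S \<and> card S \<le> min n p \<and> (\<forall>j\<in>S. sg j \<in> {-1, 1::real}) \<longrightarrow>
        \<not> (\<exists>c l t. l < p \<and> l \<notin> S \<and> t \<in> {-1, 1::real} \<and> (\<Sum>j\<in>S. c j) = 1 \<and>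
              (\<forall>i<n. (\<Sum>j\<in>S. c j * (sg j * X i j)) = t * X i l)))"

definition lasso_obj :: "nat \<Rightarrow> nat \<Rightarrow> (nat \<Rightarrow> nat \<Rightarrow> real) \<Rightarrow> (nat \<Rightarrow> real) \<Rightarrow> real \<Rightarrow> (nat \<Rightarrow> real) \<Rightarrow> real" where
  "lasso_obj n p X Y lam b = sqn n (\<lambda>i. Y i - mv p X b i) / real n + 2 * lam * (\<Sum>j<p. \<bar>b j\<bar>)"

definition lasso :: "nat \<Rightarrow> nat \<Rightarrow> (nat \<Rightarrow> nat \<Rightarrow> real) \<Rightarrow> (nat \<Rightarrow> real) \<Rightarrow> real \<Rightarrow> nat \<Rightarrow> real" where
  "lasso n p X Y lam = (SOME b. (\<forall>j\<ge>p. b j = 0) \<and>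
      (\<forall>b'. (\<forall>j\<ge>p. b' j = 0) \<longrightarrow> lasso_obj n p X Y lam b \<le> lasso_obj n p X Y lam b'))"

definition node_obj :: "nat \<Rightarrow> nat \<Rightarrow> (nat \<Rightarrow> nat \<Rightarrow> real) \<Rightarrow> real \<Rightarrow> (nat \<Rightarrow> real) \<Rightarrow> real" where
  "node_obj n p X lam g = sqn n (\<lambda>i. X i 0 - (\<Sum>j\<in>{1..<p}. X i j * g j)) / real n
      + 2 * lam * (\<Sum>j\<in>{1..<p}. \<bar>g j\<bar>)"

definition gamma_hat :: "nat \<Rightarrow> nat \<Rightarrow> (nat \<Rightarrow> nat \<Rightarrow> real) \<Rightarrow> real \<Rightarrow> nat \<Rightarrow> real" where
  "gamma_hat n p X lam = (SOME g. (\<forall>j. j = 0 \<or> p \<le> j \<longrightarrow> g j = 0) \<and>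
      (\<forall>g'. (\<forall>j. j = 0 \<or> p \<le> j \<longrightarrow> g' j = 0) \<longrightarrow> node_obj n p X lam g \<le> node_obj n p X lam g'))"

definition tau_tilde_sq :: "nat \<Rightarrow> nat \<Rightarrow> (nat \<Rightarrow> nat \<Rightarrow> real) \<Rightarrow> real \<Rightarrow> real" where
  "tau_tilde_sq n p X lam =
     sqn n (\<lambda>i. X i 0 - (\<Sum>j\<in>{1..<p}. X i j * gamma_hat n p X lam j)) / real n"

definition tau_hat_sq :: "nat \<Rightarrow> nat \<Rightarrow> (nat \<Rightarrow> nat \<Rightarrow> real) \<Rightarrow> real \<Rightarrow> real" where
  "tau_hat_sq n p X lam = tau_tilde_sq n p X lam + lam * (\<Sum>j\<in>{1..<p}. \<bar>gamma_hat n p X lam j\<bar>)"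

definition Theta_hat :: "nat \<Rightarrow> nat \<Rightarrow> (nat \<Rightarrow> nat \<Rightarrow> real) \<Rightarrow> real \<Rightarrow> nat \<Rightarrow> real" where
  "Theta_hat n p X lam = (\<lambda>j. (if j = 0 then 1 else - gamma_hat n p X lam j) / tau_hat_sq n p X lam)"

definition Sigma_hat :: "nat \<Rightarrow> (nat \<Rightarrow> nat \<Rightarrow> real) \<Rightarrow> nat \<Rightarrow> nat \<Rightarrow> real" where
  "Sigma_hat n X j l = (\<Sum>i<n. X i j * X i l) / real n"

definition debiased1 :: "nat \<Rightarrow> nat \<Rightarrow> (nat \<Rightarrow> nat \<Rightarrow> real) \<Rightarrow> (nat \<Rightarrow> real) \<Rightarrow> real \<Rightarrow> real \<Rightarrow> real" where
  "debiased1 n p X Y lam0 lam1 =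
     lasso n p X Y lam0 0 + (\<Sum>j<p. Theta_hat n p X lam1 j *
        (\<Sum>i<n. X i j * (Y i - mv p X (lasso n p X Y lam0) i))) / real n"

definition W1 :: "nat \<Rightarrow> nat \<Rightarrow> (nat \<Rightarrow> nat \<Rightarrow> real) \<Rightarrow> (nat \<Rightarrow> real) \<Rightarrow> real \<Rightarrow> real" where
  "W1 n p X eps lam1 = (\<Sum>j<p. Theta_hat n p X lam1 j * (\<Sum>i<n. X i j * eps i)) / sqrt (real n)"

definition Omega_hat :: "nat \<Rightarrow> nat \<Rightarrow> (nat \<Rightarrow> nat \<Rightarrow> real) \<Rightarrow> real \<Rightarrow> real" where
  "Omega_hat n p X lam1 = (\<Sum>j<p. \<Sum>l<p.
      Theta_hat n p X lam1 j * Sigma_hat n X j l * Theta_hat n p X lam1 l)"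

definition Delta1 :: "nat \<Rightarrow> nat \<Rightarrow> (nat \<Rightarrow> nat \<Rightarrow> real) \<Rightarrow> (nat \<Rightarrow> real) \<Rightarrow> (nat \<Rightarrow> real) \<Rightarrow> real \<Rightarrow> real \<Rightarrow> real" where
  "Delta1 n p X Y beta0 lam0 lam1 = sqrt (real n) * (\<Sum>j<p.
      ((\<Sum>l<p. Sigma_hat n X j l * Theta_hat n p X lam1 l) - (if j = 0 then 1 else 0)) *
      (beta0 j - lasso n p X Y lam0 j))"

definition matM :: "(nat \<Rightarrow> nat \<Rightarrow> real) measure" where
  "matM = PiM UNIV (\<lambda>_. PiM UNIV (\<lambda>_. (borel :: real measure)))"

definition normal_law :: "real \<Rightarrow> real measure" where
  "normal_law v = (if v \<le> 0 then return borel 0 else density lborel (normal_density 0 (sqrt v)))"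

text \<open>Probability statements along the sequence of experiments M k. Events are
  handled through measurable sub-events (inner probability), so that no statement
  becomes vacuous through non-measurability.\<close>
definition whp :: "(nat \<Rightarrow> 'a measure) \<Rightarrow> (nat \<Rightarrow> 'a \<Rightarrow> bool) \<Rightarrow> bool" where
  "whp M P \<longleftrightarrow> (\<forall>e>0. \<forall>\<^sub>F k in sequentially.
      \<exists>E\<in>sets (M k). E \<subseteq> {\<omega>\<in>space (M k). P k \<omega>} \<and> measure (M k) E \<ge> 1 - e)"

definition bounded_in_prob :: "(nat \<Rightarrow> 'a measure) \<Rightarrow> (nat \<Rightarrow> 'a \<Rightarrow> real) \<Rightarrow> bool" where
  "bounded_in_prob M Z \<longleftrightarrow> (\<forall>e>0. \<exists>C. \<forall>\<^sub>F k in sequentially.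
      \<exists>E\<in>sets (M k). E \<subseteq> {\<omega>\<in>space (M k). \<bar>Z k \<omega>\<bar> \<le> C} \<and> measure (M k) E \<ge> 1 - e)"

definition small_in_prob :: "(nat \<Rightarrow> 'a measure) \<Rightarrow> (nat \<Rightarrow> 'a \<Rightarrow> real) \<Rightarrow> bool" where
  "small_in_prob M Z \<longleftrightarrow> (\<forall>\<delta>>0. whp M (\<lambda>k \<omega>. \<bar>Z k \<omega>\<bar> \<le> \<delta>))"

end

theory Submission
  imports Defs
begin

text \<open>A minimiser \<open>b\<close> of the penalised least squares objective satisfies the variational inequality
  \<open>\<langle>X\<^sup>T(Y - X b)/n, g - b\<rangle> \<le> \<lambda> (|g|\<^sub>1 - |b|\<^sub>1)\<close> for all \<open>g\<close>. Changing one coordinate gives the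
  optimality conditions; \<open>g = \<beta>\<^sub>0\<close> gives the cone condition, hence an l1 error \<open>O(s\<^sub>0 \<lambda>\<^sub>0)\<close> for the Lasso.

  The node-wise residual \<open>r\<close> satisfies \<open>X\<^sub>0\<^sup>T r / n = \<tau>\<^sup>2\<close> (the hatted one) and \<open>|X\<^sub>j\<^sup>T r / n| \<le> \<lambda>\<^sub>1\<close>
  for the other columns, so \<open>|\<Delta>\<^sub>1| \<le> \<surd>n (\<lambda>\<^sub>1 / \<tau>\<^sup>2)\<close> times that l1 error. For \<open>\<lambda>\<^sub>1 = c / \<surd>n\<close> with
  \<open>c\<close> large, the upper sparse eigenvalue forces the node-wise Lasso to have fewer than \<open>n / K\<close> active
  coordinates, and then the lower sparse eigenvalue keeps \<open>\<tau>\<^sup>2\<close> away from zero.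

  \<open>W\<^sub>1\<close> and the variance depend on the node-wise coefficients only through \<open>r\<close>, which is unique and
  a measurable function of the design even where the coefficients are neither.\<close>

section \<open>Penalised least squares\<close>

definition dotn :: "nat \<Rightarrow> (nat \<Rightarrow> real) \<Rightarrow> (nat \<Rightarrow> real) \<Rightarrow> real" where
  "dotn n u v = (\<Sum>i<n. u i * v i)"

definition l1norm :: "'i set \<Rightarrow> ('i \<Rightarrow> real) \<Rightarrow> real" where
  "l1norm J b = (\<Sum>j\<in>J. \<bar>b j\<bar>)"

definition fit :: "'i set \<Rightarrow> (nat \<Rightarrow> 'i \<Rightarrow> real) \<Rightarrow> ('i \<Rightarrow> real) \<Rightarrow> nat \<Rightarrow> real" where
  "fit J X b i = (\<Sum>j\<in>J. X i j * b j)"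

definition resid :: "'i set \<Rightarrow> (nat \<Rightarrow> 'i \<Rightarrow> real) \<Rightarrow> (nat \<Rightarrow> real) \<Rightarrow> ('i \<Rightarrow> real) \<Rightarrow> nat \<Rightarrow> real" where
  "resid J X Y b i = Y i - fit J X b i"

definition score :: "nat \<Rightarrow> 'i set \<Rightarrow> (nat \<Rightarrow> 'i \<Rightarrow> real) \<Rightarrow> (nat \<Rightarrow> real) \<Rightarrow> ('i \<Rightarrow> real) \<Rightarrow> 'i \<Rightarrow> real" where
  "score n J X Y b j = dotn n (\<lambda>i. X i j) (resid J X Y b) / real n"

definition l1_obj :: "nat \<Rightarrow> 'i set \<Rightarrow> (nat \<Rightarrow> 'i \<Rightarrow> real) \<Rightarrow> (nat \<Rightarrow> real) \<Rightarrow> real \<Rightarrow> ('i \<Rightarrow> real) \<Rightarrow> real" where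
  "l1_obj n J X Y lam b = sqn n (resid J X Y b) / real n + 2 * lam * l1norm J b"

definition l1_min :: "nat \<Rightarrow> 'i set \<Rightarrow> (nat \<Rightarrow> 'i \<Rightarrow> real) \<Rightarrow> (nat \<Rightarrow> real) \<Rightarrow> real \<Rightarrow> ('i \<Rightarrow> real) \<Rightarrow> bool" where
  "l1_min n J X Y lam b \<longleftrightarrow> (\<forall>j. j \<notin> J \<longrightarrow> b j = 0) \<and>
     (\<forall>b'. (\<forall>j. j \<notin> J \<longrightarrow> b' j = 0) \<longrightarrow> l1_obj n J X Y lam b \<le> l1_obj n J X Y lam b')"

lemma sqn_nonneg [simp]: "0 \<le> sqn n v"
  by (simp add: sqn_def sum_nonneg)

lemma dotn_self: "dotn n v v = sqn n v"
  by (simp add: dotn_def sqn_def power2_eq_square)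

lemma dotn_commute: "dotn n u v = dotn n v u"
  by (simp add: dotn_def mult.commute)

lemma dotn_add_right: "dotn n u (\<lambda>i. v i + w i) = dotn n u v + dotn n u w"
  by (simp add: dotn_def distrib_left sum.distrib)

lemma dotn_diff_right: "dotn n u (\<lambda>i. v i - w i) = dotn n u v - dotn n u w"
  by (simp add: dotn_def right_diff_distrib sum_subtractf)

lemma dotn_power2_le: "(dotn n u v)^2 \<le> sqn n u * sqn n v"
  unfolding dotn_def sqn_def by (rule Cauchy_Schwarz_ineq_sum)

lemma dotn_fit: "dotn n (fit J X b) w = (\<Sum>j\<in>J. b j * dotn n (\<lambda>i. X i j) w)"
  unfolding dotn_def fit_def sum_distrib_left sum_distrib_right
  by (subst sum.swap) (simp add: mult_ac)

lemma sqn_diff: "sqn n (\<lambda>i. u i - v i) = sqn n u - 2 * dotn n u v + sqn n v"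
  by (simp add: sqn_def dotn_def power2_diff sum.distrib sum_subtractf sum_distrib_left mult_ac)

lemma sqn_scale: "sqn n (\<lambda>i. t * v i) = t^2 * sqn n v"
  by (simp add: sqn_def power_mult_distrib sum_distrib_left)

lemma l1norm_nonneg [simp]: "0 \<le> l1norm J b"
  by (simp add: l1norm_def sum_nonneg)

lemma l1norm_subset_diff:
  "finite J \<Longrightarrow> S \<subseteq> J \<Longrightarrow> l1norm J b = l1norm S b + l1norm (J - S) b"
  unfolding l1norm_def by (subst sum.subset_diff) auto

lemma l1norm_convex_combination_le:
  assumes t: "0 \<le> t" "t \<le> 1"
  shows "l1norm J (\<lambda>j. b j + t * (g j - b j)) \<le> l1norm J b + t * (l1norm J g - l1norm J b)"
proof -
  have "\<bar>b j + t * (g j - b j)\<bar> \<le> \<bar>b j\<bar> + t * (\<bar>g j\<bar> - \<bar>b j\<bar>)" for j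
  proof -
    have "\<bar>b j + t * (g j - b j)\<bar> = \<bar>(1 - t) * b j + t * g j\<bar>" by (simp add: algebra_simps)
    also have "\<dots> \<le> (1 - t) * \<bar>b j\<bar> + t * \<bar>g j\<bar>"
      using t abs_triangle_ineq[of "(1 - t) * b j" "t * g j"] by (simp add: abs_mult)
    finally show ?thesis by (simp add: algebra_simps)
  qed
  then show ?thesis
    unfolding l1norm_def
    by (simp add: sum_mono sum_subtractf[symmetric] sum.distrib[symmetric] sum_distrib_left)
qed

lemma l1norm_le_if_sum_squares_le:
  assumes kap: "0 < kap" and a: "0 \<le> a" and quad: "kap * (\<Sum>j\<in>S. (d j)^2) \<le> a * l1norm S d"
  shows "kap * l1norm S d \<le> a * real (card S)"
proof -
  let ?L = "l1norm S d" and ?s = "real (card S)"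
  have "?L^2 \<le> (\<Sum>j\<in>S. (d j)^2) * ?s"
    using sum_squared_le_sum_of_squares[of "\<lambda>j. \<bar>d j\<bar>" S] by (simp add: l1norm_def)
  then have "kap * ?L^2 \<le> ?s * (kap * (\<Sum>j\<in>S. (d j)^2))"
    using kap by (simp add: mult_ac)
  also have "\<dots> \<le> ?s * (a * ?L)"
    using quad by (intro mult_left_mono) auto
  finally have "?L * (kap * ?L) \<le> ?L * (a * ?s)"
    by (simp add: power2_eq_square mult_ac)
  then show ?thesis
    using a l1norm_nonneg[of S d] by (cases "?L = 0") auto
qed

lemma abs_sum_mult_le_l1norm:
  assumes "\<And>j. j \<in> J \<Longrightarrow> \<bar>a j\<bar> \<le> c"
  shows "\<bar>\<Sum>j\<in>J. d j * a j\<bar> \<le> c * l1norm J d"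
proof -
  have "\<bar>\<Sum>j\<in>J. d j * a j\<bar> \<le> (\<Sum>j\<in>J. \<bar>d j\<bar> * \<bar>a j\<bar>)"
    using sum_abs[of "\<lambda>j. d j * a j" J] by (simp add: abs_mult)
  also have "\<dots> \<le> (\<Sum>j\<in>J. \<bar>d j\<bar> * c)"
    using assms by (intro sum_mono mult_left_mono) auto
  finally show ?thesis
    by (simp add: l1norm_def sum_distrib_left mult.commute)
qed

lemma l1_obj_cong: "(\<And>j. j \<in> J \<Longrightarrow> b j = b' j) \<Longrightarrow> l1_obj n J X Y lam b = l1_obj n J X Y lam b'"
  by (simp add: l1_obj_def l1norm_def resid_def fit_def sqn_def cong: sum.cong)

lemma l1_min_le:
  assumes "l1_min n J X Y lam b"
  shows "l1_obj n J X Y lam b \<le> l1_obj n J X Y lam b'"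
proof -
  have "l1_obj n J X Y lam b \<le> l1_obj n J X Y lam (\<lambda>j. if j \<in> J then b' j else 0)"
    using assms by (simp add: l1_min_def)
  also have "\<dots> = l1_obj n J X Y lam b'"
    by (rule l1_obj_cong) simp
  finally show ?thesis .
qed

lemma l1_obj_attains_min_on_box:
  fixes J :: "'i set"
  assumes "0 \<le> R"
  obtains b where "\<And>j. j \<notin> J \<Longrightarrow> b j = 0"
    and "\<And>b'. (\<And>j. j \<in> J \<Longrightarrow> \<bar>b' j\<bar> \<le> R) \<Longrightarrow> l1_obj n J X Y lam b \<le> l1_obj n J X Y lam b'"
proof -
  define T where "T j = (if j \<in> J then {-R..R} else {0})" for j
  have "compactin (product_topology (\<lambda>_. euclidean) UNIV) (PiE UNIV T)"
    unfolding compactin_PiE by (auto simp: T_def)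
  then have "compact (PiE UNIV T)"
    by (simp add: euclidean_product_topology)
  moreover have "(\<lambda>_. 0) \<in> PiE UNIV T"
    using assms by (auto simp: T_def)
  moreover have "continuous_on (PiE UNIV T) (l1_obj n J X Y lam)"
    unfolding l1_obj_def[abs_def] l1norm_def resid_def fit_def sqn_def divide_inverse
    by (intro continuous_intros continuous_on_const
        continuous_on_subset[OF continuous_on_product_coordinates]) auto
  ultimately obtain b where b: "b \<in> PiE UNIV T"
      and min: "\<forall>b'\<in>PiE UNIV T. l1_obj n J X Y lam b \<le> l1_obj n J X Y lam b'"
    using continuous_attains_inf[of "PiE UNIV T" "l1_obj n J X Y lam"] by blast
  show thesis
  proof
    show "b j = 0" if "j \<notin> J" for j
      using b that by (auto simp: T_def PiE_iff dest!: spec[of _ j])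
    fix b' :: "'i \<Rightarrow> real" assume b': "\<And>j. j \<in> J \<Longrightarrow> \<bar>b' j\<bar> \<le> R"
    have "(\<lambda>j. if j \<in> J then b' j else 0) \<in> PiE UNIV T"
      using b' by (fastforce simp: T_def abs_le_iff)
    then have "l1_obj n J X Y lam b \<le> l1_obj n J X Y lam (\<lambda>j. if j \<in> J then b' j else 0)"
      using min by blast
    also have "\<dots> = l1_obj n J X Y lam b'"
      by (rule l1_obj_cong) simp
    finally show "l1_obj n J X Y lam b \<le> l1_obj n J X Y lam b'" .
  qed
qed

lemma l1_min_exists:
  assumes "finite J" and lam: "0 < lam"
  shows "\<exists>b. l1_min n J X Y lam b"
proof -
  define R where "R = l1_obj n J X Y lam (\<lambda>_. 0) / (2 * lam)"
  have R: "0 \<le> R"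
    using lam by (simp add: R_def l1_obj_def)
  then obtain b where supp: "\<And>j. j \<notin> J \<Longrightarrow> b j = 0"
    and box: "\<And>b'. (\<And>j. j \<in> J \<Longrightarrow> \<bar>b' j\<bar> \<le> R) \<Longrightarrow> l1_obj n J X Y lam b \<le> l1_obj n J X Y lam b'"
    using l1_obj_attains_min_on_box by metis
  have "l1_obj n J X Y lam b \<le> l1_obj n J X Y lam b'" for b'
  proof (cases "\<forall>j\<in>J. \<bar>b' j\<bar> \<le> R")
    case True
    then show ?thesis by (intro box) auto
  next
    case False
    then obtain j where "j \<in> J" "R < \<bar>b' j\<bar>" by force
    moreover have "\<bar>b' j\<bar> \<le> l1norm J b'"
      unfolding l1norm_def using \<open>finite J\<close> \<open>j \<in> J\<close> by (intro member_le_sum) auto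
    ultimately have "R < l1norm J b'" by simp
    then have "l1_obj n J X Y lam (\<lambda>_. 0) < 2 * lam * l1norm J b'"
      using lam by (simp add: R_def field_simps)
    also have "\<dots> \<le> l1_obj n J X Y lam b'"
      by (simp add: l1_obj_def)
    finally show ?thesis
      using box[of "\<lambda>_. 0"] R by simp
  qed
  with supp show ?thesis
    unfolding l1_min_def by blast
qed

lemma l1_obj_expand:
  "l1_obj n J X Y lam g = l1_obj n J X Y lam b - 2 * (\<Sum>j\<in>J. (g j - b j) * score n J X Y b j)
    + sqn n (fit J X (\<lambda>j. g j - b j)) / real n + 2 * lam * (l1norm J g - l1norm J b)"
proof -
  let ?r = "resid J X Y b" and ?d = "fit J X (\<lambda>j. g j - b j)"
  have "resid J X Y g = (\<lambda>i. ?r i - ?d i)"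
    by (rule ext) (simp add: resid_def fit_def algebra_simps sum_subtractf)
  then have "sqn n (resid J X Y g) = sqn n ?r - 2 * dotn n ?d ?r + sqn n ?d"
    by (simp add: sqn_diff dotn_commute)
  moreover have "dotn n ?d ?r / real n = (\<Sum>j\<in>J. (g j - b j) * score n J X Y b j)"
    by (simp add: dotn_fit score_def sum_divide_distrib)
  ultimately show ?thesis
    by (simp add: l1_obj_def add_divide_distrib diff_divide_distrib right_diff_distrib)
qed

lemma l1_min_variational:
  assumes b: "l1_min n J X Y lam b" and lam: "0 \<le> lam"
  shows "(\<Sum>j\<in>J. (g j - b j) * score n J X Y b j) \<le> lam * (l1norm J g - l1norm J b)"
proof -
  let ?S = "\<Sum>j\<in>J. (g j - b j) * score n J X Y b j" and ?D = "l1norm J g - l1norm J b"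
  let ?Q = "sqn n (fit J X (\<lambda>j. g j - b j)) / real n"
  have small_step: "2 * (?S - lam * ?D) \<le> t * ?Q" if t: "0 < t" "t < 1" for t
  proof -
    define h where "h j = b j + t * (g j - b j)" for j
    have "l1norm J h \<le> l1norm J b + t * ?D"
      using t l1norm_convex_combination_le[of t J b g] by (simp add: h_def[abs_def])
    then have "lam * (l1norm J h - l1norm J b) \<le> lam * (t * ?D)"
      using lam by (intro mult_left_mono) auto
    moreover have "(\<Sum>j\<in>J. (h j - b j) * score n J X Y b j) = t * ?S"
      by (simp add: h_def sum_distrib_left mult.assoc)
    moreover have "fit J X (\<lambda>j. h j - b j) = (\<lambda>i. t * fit J X (\<lambda>j. g j - b j) i)"
      by (rule ext) (simp add: fit_def h_def sum_distrib_left mult_ac)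
    ultimately have "t * (2 * (?S - lam * ?D)) \<le> t * (t * ?Q)"
      using l1_min_le[OF b, of h] l1_obj_expand[of n J X Y lam h b]
      by (simp add: sqn_scale power2_eq_square algebra_simps)
    then show ?thesis using mult_le_cancel_left_pos[OF t(1)] by blast
  qed
  have "2 * (?S - lam * ?D) \<le> 0 * ?Q"
  proof (rule tendsto_lowerbound)
    show "((\<lambda>t. t * ?Q) \<longlongrightarrow> 0 * ?Q) (at_right 0)" by (intro tendsto_intros)
    show "\<forall>\<^sub>F t in at_right 0. 2 * (?S - lam * ?D) \<le> t * ?Q"
      using eventually_at_right_less[of 0] eventually_at_right_field[of _ "0::real"] small_step
      by (auto intro: exI[of _ 1])
  qed simp
  then show ?thesis by simp
qed

lemma l1_min_coordinate_variational:
  assumes "finite J" "j \<in> J" and b: "l1_min n J X Y lam b" and lam: "0 \<le> lam"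
  shows "t * score n J X Y b j \<le> lam * (\<bar>b j + t\<bar> - \<bar>b j\<bar>)"
proof -
  let ?g = "b(j := b j + t)"
  have "(\<Sum>k\<in>J. (?g k - b k) * score n J X Y b k) = (\<Sum>k\<in>J. if k = j then t * score n J X Y b j else 0)"
    by (intro sum.cong) auto
  moreover have "l1norm J ?g - l1norm J b = (\<Sum>k\<in>J. if k = j then \<bar>b j + t\<bar> - \<bar>b j\<bar> else 0)"
    unfolding l1norm_def sum_subtractf[symmetric] by (intro sum.cong) auto
  ultimately show ?thesis
    using l1_min_variational[OF b lam, of ?g] assms(1,2) by simp
qed

lemma l1_min_abs_score_le:
  assumes "finite J" "j \<in> J" "l1_min n J X Y lam b" and lam: "0 \<le> lam"
  shows "\<bar>score n J X Y b j\<bar> \<le> lam"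
proof -
  have "\<bar>score n J X Y b j\<bar> = sgn (score n J X Y b j) * score n J X Y b j"
    by (simp add: abs_sgn mult.commute)
  also have "\<dots> \<le> lam * (\<bar>b j + sgn (score n J X Y b j)\<bar> - \<bar>b j\<bar>)"
    by (rule l1_min_coordinate_variational[OF assms])
  also have "\<dots> \<le> lam * 1"
    using lam by (intro mult_left_mono) (auto simp: sgn_if)
  finally show ?thesis by simp
qed

lemma l1_min_mult_score:
  assumes "finite J" "j \<in> J" "l1_min n J X Y lam b" "0 \<le> lam"
  shows "b j * score n J X Y b j = lam * \<bar>b j\<bar>"
proof (rule antisym)
  have "\<bar>b j + b j\<bar> - \<bar>b j\<bar> = \<bar>b j\<bar>" by linarith
  then show "b j * score n J X Y b j \<le> lam * \<bar>b j\<bar>"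
    using l1_min_coordinate_variational[OF assms, of "b j"] by simp
  show "lam * \<bar>b j\<bar> \<le> b j * score n J X Y b j"
    using l1_min_coordinate_variational[OF assms, of "- b j"] by simp
qed

lemma l1_min_score_power2_if_active:
  assumes "finite J" "j \<in> J" "l1_min n J X Y lam b" "0 \<le> lam" and nz: "b j \<noteq> 0"
  shows "(score n J X Y b j)^2 = lam^2"
proof -
  have "(b j)^2 * (score n J X Y b j)^2 = (b j)^2 * lam^2"
    using l1_min_mult_score[OF assms(1-4)] by (metis mult.commute power2_abs power_mult_distrib)
  with nz show ?thesis by simp
qed

text \<open>Hence the fit is unique even where the minimiser is not.\<close>

lemma l1_min_sqn_fit_le:
  assumes "l1_min n J X Y lam b" "0 \<le> lam"
  shows "sqn n (fit J X (\<lambda>j. g j - b j)) / real n \<le> l1_obj n J X Y lam g - l1_obj n J X Y lam b"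
  using l1_min_variational[OF assms, of g] l1_obj_expand[of n J X Y lam g b]
  by (simp add: algebra_simps)

lemma l1_min_sqn_resid_le:
  assumes "l1_min n J X Y lam b" "0 \<le> lam"
  shows "sqn n (resid J X Y b) / real n \<le> sqn n Y / real n"
proof -
  have "l1_obj n J X Y lam b \<le> l1_obj n J X Y lam (\<lambda>_. 0)"
    using assms(1) by (rule l1_min_le)
  moreover have "0 \<le> lam * l1norm J b"
    using assms(2) by simp
  ultimately show ?thesis
    by (simp add: l1_obj_def l1norm_def resid_def[abs_def] fit_def)
qed

lemma l1_min_dotn_resid:
  assumes "finite J" "l1_min n J X Y lam b" "0 \<le> lam"
  shows "dotn n Y (resid J X Y b) / real n = sqn n (resid J X Y b) / real n + lam * l1norm J b"
proof -
  let ?r = "resid J X Y b"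
  have "dotn n (fit J X b) ?r / real n = (\<Sum>j\<in>J. b j * score n J X Y b j)"
    by (simp add: dotn_fit score_def sum_divide_distrib)
  also have "\<dots> = lam * l1norm J b"
    unfolding l1norm_def sum_distrib_left using assms by (intro sum.cong l1_min_mult_score) auto
  finally have "dotn n (fit J X b) ?r / real n = lam * l1norm J b" .
  moreover have "Y = (\<lambda>i. ?r i + fit J X b i)" by (simp add: resid_def)
  then have "dotn n Y ?r = sqn n ?r + dotn n (fit J X b) ?r"
    by (metis dotn_add_right dotn_commute dotn_self)
  ultimately show ?thesis by (simp add: add_divide_distrib)
qed

lemma mv_eq_fit: "mv p X = fit {..<p} X"
  by (simp add: fun_eq_iff mv_def fit_def)

lemma lasso_is_l1_min:
  assumes "0 < lam"
  shows "l1_min n {..<p} X Y lam (lasso n p X Y lam)"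
proof -
  have "l1_min n {..<p} X Y lam b \<longleftrightarrow> (\<forall>j\<ge>p. b j = 0) \<and>
      (\<forall>b'. (\<forall>j\<ge>p. b' j = 0) \<longrightarrow> lasso_obj n p X Y lam b \<le> lasso_obj n p X Y lam b')" for b
    by (simp add: l1_min_def l1_obj_def lasso_obj_def l1norm_def resid_def[abs_def] mv_eq_fit not_less)
  then show ?thesis
    using someI_ex[OF l1_min_exists[of "{..<p}" lam n X Y]] assms unfolding lasso_def by simp
qed

section \<open>Sparse eigenvalues\<close>

lemma sqn_pos_iff: "0 < sqn p z \<longleftrightarrow> (\<exists>j<p. z j \<noteq> 0)"
proof -
  have "sqn p z = 0 \<longleftrightarrow> (\<forall>j<p. z j = 0)"
    unfolding sqn_def by (subst sum_nonneg_eq_0_iff) auto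
  then show ?thesis using sqn_nonneg[of p z] by (metis less_le)
qed

lemma l0norm_pos_iff: "1 \<le> l0norm p z \<longleftrightarrow> 0 < sqn p z"
  unfolding l0norm_def sqn_pos_iff by (auto simp: Suc_le_eq card_gt_0_iff)

lemma sqn_mv_le_frobenius: "sqn n (mv p X z) \<le> (\<Sum>i<n. sqn p (X i)) * sqn p z"
  unfolding sqn_def mv_def sum_distrib_right
  by (intro sum_mono) (metis Cauchy_Schwarz_ineq_sum sum_distrib_right)

lemma sqn_mv_le_phi_max:
  assumes z: "\<forall>j\<ge>p. z j = 0" "l0norm p z \<le> s"
  shows "sqn n (mv p X z) / real n \<le> phi_max n p X s * sqn p z"
proof (cases "0 < sqn p z")
  case True
  let ?q = "\<lambda>z. sqn n (mv p X z) / (real n * sqn p z)"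
  let ?Q = "{?q z | z. (\<forall>j\<ge>p. z j = 0) \<and> 1 \<le> l0norm p z \<and> l0norm p z \<le> s}"
  have "?q z \<le> (\<Sum>i<n. sqn p (X i)) / real n" if "1 \<le> l0norm p z" for z
  proof -
    have "sqn n (mv p X z) / sqn p z \<le> (\<Sum>i<n. sqn p (X i))"
      using sqn_mv_le_frobenius[of n p X z] that[unfolded l0norm_pos_iff] by (simp add: divide_le_eq)
    from divide_right_mono[OF this, of "real n"] show ?thesis by (simp add: mult.commute)
  qed
  then have "bdd_above ?Q"
    by (intro bdd_aboveI[of _ "(\<Sum>i<n. sqn p (X i)) / real n"]) blast
  moreover have "?q z \<in> ?Q" using z True l0norm_pos_iff by blast
  ultimately have "?q z \<le> phi_max n p X s"
    unfolding phi_max_def sqn_def[of p, symmetric] by (rule cSup_upper[rotated])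
  then show ?thesis
    using True by (cases "n = 0") (auto simp: field_simps)
next
  case False
  then have "sqn p z = 0"
    using sqn_nonneg[of p z] by linarith
  with sqn_mv_le_frobenius[of n p X z] show ?thesis
    using sqn_nonneg[of n "mv p X z"] by simp
qed

lemma sqn_column_le_phi_max:
  assumes "j < p" "1 \<le> s"
  shows "sqn n (\<lambda>i. X i j) / real n \<le> phi_max n p X s"
proof -
  define e where "e l = (if l = j then 1 else 0 :: real)" for l
  have "l0norm p e \<le> card {j}"
    unfolding l0norm_def by (intro card_mono) (auto simp: e_def)
  then have "sqn n (mv p X e) / real n \<le> phi_max n p X s * sqn p e"
    using assms by (intro sqn_mv_le_phi_max) (auto simp: e_def)
  moreover have "sqn p e = 1" "mv p X e = (\<lambda>i. X i j)"
    using assms by (auto simp: sqn_def mv_def e_def if_distrib[of "\<lambda>x. x^2"] if_distrib[of "\<lambda>x. _ * x"] cong: if_cong)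
  ultimately show ?thesis by simp
qed

lemma phi_min_le_sqn_mv:
  assumes z: "\<forall>j\<ge>p. z j = 0" "1 \<le> l0norm p z" "l0norm p z \<le> s" and n: "0 < n"
  shows "phi_min n p X s * sqn p z \<le> sqn n (mv p X z) / real n"
proof -
  let ?q = "\<lambda>z. sqn n (mv p X z) / (real n * sqn p z)"
  let ?Q = "{?q z | z. (\<forall>j\<ge>p. z j = 0) \<and> 1 \<le> l0norm p z \<and> l0norm p z \<le> s}"
  have "bdd_below ?Q"
    by (intro bdd_belowI[of _ 0]) auto
  moreover have "?q z \<in> ?Q" using z by blast
  ultimately have "phi_min n p X s \<le> ?q z"
    unfolding phi_min_def sqn_def[of p, symmetric] by (rule cInf_lower[rotated])
  then show ?thesis
    using z(2)[unfolded l0norm_pos_iff] n by (simp add: field_simps)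
qed

lemma kappa_sq_le_sqn_mv:
  assumes S: "S \<subseteq> {..<p}" "card S \<le> s" and z: "\<forall>j\<ge>p. z j = 0"
    and cone: "l1norm ({..<p} - S) z \<le> c0 * l1norm S z" and n: "0 < n"
  shows "kappa_sq n p X s c0 * (\<Sum>j\<in>S. (z j)^2) \<le> sqn n (mv p X z) / real n"
proof (cases "(\<Sum>j\<in>S. (z j)^2) = 0")
  case True
  then show ?thesis by (simp only: mult_zero_right) simp
next
  case False
  then have pos: "0 < (\<Sum>j\<in>S. (z j)^2)" by (simp add: less_le sum_nonneg)
  let ?q = "\<lambda>S z. sqn n (mv p X z) / (real n * (\<Sum>j\<in>S. (z j)^2))"
  let ?Q = "{?q S z | S z.
      S \<subseteq> {..<p} \<and> card S \<le> s \<and> (\<forall>j\<ge>p. z j = 0) \<and> (\<exists>j<p. z j \<noteq> 0) \<and>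
      (\<Sum>j\<in>{..<p} - S. \<bar>z j\<bar>) \<le> c0 * (\<Sum>j\<in>S. \<bar>z j\<bar>)}"
  have "bdd_below ?Q"
    by (intro bdd_belowI[of _ 0]) (auto intro!: divide_nonneg_nonneg mult_nonneg_nonneg sum_nonneg)
  moreover have "\<exists>j<p. z j \<noteq> 0"
    using False S(1) by (metis (no_types, lifting) lessThan_iff subsetD sum.neutral zero_power2)
  then have "?q S z \<in> ?Q" using S z cone[unfolded l1norm_def] by blast
  ultimately have "kappa_sq n p X s c0 \<le> ?q S z"
    unfolding kappa_sq_def by (rule cInf_lower[rotated])
  then show ?thesis using pos n by (simp add: field_simps)
qed

section \<open>The l1 error of the Lasso\<close>

lemma l1norm_diff_le_cone:
  assumes "finite J" "S \<subseteq> J" and beta: "\<And>j. j \<in> J - S \<Longrightarrow> beta j = 0"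
  shows "l1norm J beta - l1norm J b \<le> l1norm S (\<lambda>j. b j - beta j) - l1norm (J - S) (\<lambda>j. b j - beta j)"
proof -
  have "l1norm S beta - l1norm S b \<le> l1norm S (\<lambda>j. b j - beta j)"
    unfolding l1norm_def sum_subtractf[symmetric] by (intro sum_mono) auto
  moreover have "l1norm (J - S) beta = 0" "l1norm (J - S) (\<lambda>j. b j - beta j) = l1norm (J - S) b"
    using beta by (simp_all add: l1norm_def)
  ultimately show ?thesis
    using l1norm_subset_diff[OF assms(1,2)] by simp
qed

lemma l1_min_basic_inequality:
  assumes "finite J" "S \<subseteq> J" and b: "l1_min n J X Y lam b" and lam: "0 \<le> lam"
    and Y: "\<And>i. i < n \<Longrightarrow> Y i = fit J X beta i + e i"
    and beta: "\<And>j. j \<in> J - S \<Longrightarrow> beta j = 0"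
    and noise: "\<And>j. j \<in> J \<Longrightarrow> \<bar>dotn n (\<lambda>i. X i j) e / real n\<bar> \<le> lam / 2"
  defines "d \<equiv> \<lambda>j. b j - beta j"
  shows "sqn n (fit J X d) / real n + lam / 2 * l1norm (J - S) d \<le> 3 / 2 * lam * l1norm S d"
proof -
  let ?noise = "\<lambda>j. dotn n (\<lambda>i. X i j) e / real n"
  have "dotn n (fit J X d) (resid J X Y b) = dotn n (fit J X d) (\<lambda>i. e i - fit J X d i)"
    unfolding dotn_def
    by (intro sum.cong) (simp_all add: Y resid_def d_def fit_def algebra_simps sum_subtractf)
  also have "\<dots> = dotn n (fit J X d) e - sqn n (fit J X d)"
    by (simp add: dotn_diff_right dotn_self)
  finally have "(\<Sum>j\<in>J. d j * score n J X Y b j) = (\<Sum>j\<in>J. d j * ?noise j) - sqn n (fit J X d) / real n"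
    by (simp add: dotn_fit score_def sum_divide_distrib[symmetric] diff_divide_distrib)
  moreover have "- (\<Sum>j\<in>J. d j * score n J X Y b j) \<le> lam * (l1norm J beta - l1norm J b)"
    using l1_min_variational[OF b lam, of beta] by (simp add: d_def sum_negf[symmetric] algebra_simps)
  ultimately have "sqn n (fit J X d) / real n \<le> (\<Sum>j\<in>J. d j * ?noise j) + lam * (l1norm J beta - l1norm J b)"
    by linarith
  also have "(\<Sum>j\<in>J. d j * ?noise j) \<le> lam / 2 * l1norm J d"
    using abs_sum_mult_le_l1norm[of J ?noise "lam / 2" d] noise by force
  also have "lam * (l1norm J beta - l1norm J b) \<le> lam * (l1norm S d - l1norm (J - S) d)"
    unfolding d_def using lam beta by (intro mult_left_mono l1norm_diff_le_cone assms(1,2)) auto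
  finally show ?thesis
    unfolding l1norm_subset_diff[OF assms(1,2), of d] by (simp add: algebra_simps)
qed

lemma lasso_l1_error:
  assumes b: "l1_min n {..<p} X Y lam b" and lam: "0 < lam" and n: "0 < n"
    and Y: "\<And>i. i < n \<Longrightarrow> Y i = mv p X beta i + e i" and beta: "\<forall>j\<ge>p. beta j = 0"
    and noise: "\<And>j. j < p \<Longrightarrow> \<bar>dotn n (\<lambda>i. X i j) e / real n\<bar> \<le> lam / 2"
    and kap: "0 < kap" "kap \<le> kappa_sq n p X (l0norm p beta) 3"
  shows "l1norm {..<p} (\<lambda>j. b j - beta j) \<le> 6 * lam * real (l0norm p beta) / kap"
proof -
  define S where "S = {j. j < p \<and> beta j \<noteq> 0}"
  define d where "d j = b j - beta j" for j
  let ?s = "real (l0norm p beta)" and ?L = "l1norm S d"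
  have S: "S \<subseteq> {..<p}" "card S = l0norm p beta" by (auto simp: S_def l0norm_def)
  have basic: "sqn n (mv p X d) / real n + lam / 2 * l1norm ({..<p} - S) d \<le> 3 / 2 * lam * ?L"
    using l1_min_basic_inequality[OF _ S(1) b less_imp_le[OF lam] Y[unfolded mv_eq_fit]] noise
    by (simp add: mv_eq_fit d_def[abs_def] S_def)
  moreover have "0 \<le> sqn n (mv p X d) / real n" by simp
  moreover have "3 / 2 * lam * ?L = lam / 2 * (3 * ?L)" by simp
  ultimately have "lam / 2 * l1norm ({..<p} - S) d \<le> lam / 2 * (3 * ?L)" by linarith
  then have cone: "l1norm ({..<p} - S) d \<le> 3 * ?L" using lam by simp
  have "kap * (\<Sum>j\<in>S. (d j)^2) \<le> kappa_sq n p X (l0norm p beta) 3 * (\<Sum>j\<in>S. (d j)^2)"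
    by (intro mult_right_mono kap sum_nonneg) auto
  also have "\<dots> \<le> sqn n (mv p X d) / real n"
    using b beta by (intro kappa_sq_le_sqn_mv S eq_refl cone n) (auto simp: d_def l1_min_def)
  also have "\<dots> \<le> 3 / 2 * lam * ?L"
  proof -
    have "0 \<le> lam / 2 * l1norm ({..<p} - S) d" using lam by simp
    with basic show ?thesis by linarith
  qed
  finally have quad: "kap * (\<Sum>j\<in>S. (d j)^2) \<le> 3 / 2 * lam * ?L" .
  have "kap * ?L \<le> 3 / 2 * lam * ?s"
    using l1norm_le_if_sum_squares_le[OF kap(1) _ quad] lam by (simp add: S(2))
  then have "4 * ?L \<le> 6 * lam * ?s / kap" using kap by (simp add: field_simps)
  moreover have "l1norm {..<p} d \<le> 4 * ?L"
    using cone l1norm_subset_diff[OF _ S(1), of d] by simp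
  ultimately show ?thesis by (simp add: d_def[abs_def])
qed

section \<open>Sparsity of penalised minimisers\<close>

text \<open>The score has modulus \<open>lam\<close> on active coordinates, so its restriction \<open>z\<close> to \<open>S\<close> has squared norm
  \<open>card S * lam^2\<close>; this is also the inner product of \<open>X z\<close> with the residual over \<open>n\<close>.\<close>

lemma l1_min_active_subset_card_le:
  assumes b: "l1_min n J X Y lam b" and lam: "0 < lam" and J: "J \<subseteq> {..<p}"
    and S: "S \<subseteq> {j\<in>J. b j \<noteq> 0}" "S \<noteq> {}" "card S \<le> s"
  shows "real (card S) * lam^2 \<le> phi_max n p X s * (sqn n (resid J X Y b) / real n)"
proof -
  let ?r = "resid J X Y b"
  define z where "z j = (if j \<in> S then score n J X Y b j else 0)" for j
  define N where "N = real (card S) * lam^2"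
  have Sp: "S \<subseteq> {..<p}" "finite S" "finite J"
    using S(1) J by (auto intro: finite_subset)
  have "(score n J X Y b j)^2 = lam^2" if "j \<in> S" for j
    using that S(1) lam Sp(3) by (intro l1_min_score_power2_if_active[OF _ _ b]) auto
  moreover have restrict: "(\<Sum>j<p. z j * f j) = (\<Sum>j\<in>S. score n J X Y b j * f j)" for f
    using Sp by (intro sum.mono_neutral_cong_right) (auto simp: z_def)
  ultimately have N: "sqn p z = N" "(\<Sum>j\<in>S. score n J X Y b j * score n J X Y b j) = N"
    using restrict[of z] by (simp_all add: sqn_def N_def power2_eq_square z_def)
  have "N = dotn n (mv p X z) ?r / real n"
    unfolding mv_eq_fit dotn_fit restrict N(2)[symmetric] by (simp add: score_def sum_divide_distrib)
  then have "N^2 \<le> sqn n (mv p X z) * sqn n ?r / real n^2"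
    using dotn_power2_le[of n "mv p X z" ?r] by (simp add: power_divide divide_right_mono)
  also have "\<dots> = sqn n (mv p X z) / real n * (sqn n ?r / real n)"
    by (simp add: power2_eq_square)
  also have "\<dots> \<le> phi_max n p X s * N * (sqn n ?r / real n)"
  proof (rule mult_right_mono)
    have "l0norm p z \<le> card S"
      unfolding l0norm_def using Sp by (intro card_mono) (auto simp: z_def split: if_splits)
    then show "sqn n (mv p X z) / real n \<le> phi_max n p X s * N"
      using sqn_mv_le_phi_max[of p z s n X] S(3) Sp(1) unfolding N(1) by (force simp: z_def)
  qed simp
  finally have "N * N \<le> N * (phi_max n p X s * (sqn n ?r / real n))"
    by (simp add: power2_eq_square mult_ac)
  moreover have "0 < N"
    using Sp lam S(2) by (simp add: N_def card_gt_0_iff)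
  ultimately show ?thesis
    unfolding N_def[symmetric] using mult_le_cancel_left_pos by blast
qed

lemma l1_min_card_active_less:
  assumes b: "l1_min n J X Y lam b" and lam: "0 < lam" and J: "J \<subseteq> {..<p}"
    and m: "0 < m" "m \<le> s" and C: "0 \<le> C" "phi_max n p X s \<le> C"
    and V: "sqn n Y / real n \<le> V" and large: "C * V < real m * lam^2"
  shows "card {j\<in>J. b j \<noteq> 0} < m"
proof (rule ccontr)
  assume "\<not> ?thesis"
  then obtain S where S: "S \<subseteq> {j\<in>J. b j \<noteq> 0}" "card S = m"
    by (meson not_less obtain_subset_with_card_n)
  let ?q = "sqn n (resid J X Y b) / real n"
  have "real m * lam^2 \<le> phi_max n p X s * ?q"
    using l1_min_active_subset_card_le[OF b lam J S(1)] S(2) m by fastforce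
  also have "\<dots> \<le> C * ?q"
    using C by (intro mult_right_mono) auto
  also have "\<dots> \<le> C * V"
    using l1_min_sqn_resid_le[OF b less_imp_le[OF lam]] V C by (intro mult_left_mono) auto
  finally show False using large by simp
qed

section \<open>The node-wise Lasso\<close>

definition node_resid :: "nat \<Rightarrow> nat \<Rightarrow> (nat \<Rightarrow> nat \<Rightarrow> real) \<Rightarrow> real \<Rightarrow> nat \<Rightarrow> real" where
  "node_resid n p X lam = resid {1..<p} X (\<lambda>i. X i 0) (gamma_hat n p X lam)"

definition node_score :: "nat \<Rightarrow> nat \<Rightarrow> (nat \<Rightarrow> nat \<Rightarrow> real) \<Rightarrow> real \<Rightarrow> nat \<Rightarrow> real" where
  "node_score n p X lam = score n {1..<p} X (\<lambda>i. X i 0) (gamma_hat n p X lam)"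

definition node_coef :: "nat \<Rightarrow> nat \<Rightarrow> (nat \<Rightarrow> nat \<Rightarrow> real) \<Rightarrow> real \<Rightarrow> nat \<Rightarrow> real" where
  "node_coef n p X lam j = (if j = 0 then 1 else - gamma_hat n p X lam j)"

lemma node_score_eq: "node_score n p X lam j = dotn n (\<lambda>i. X i j) (node_resid n p X lam) / real n"
  by (simp add: node_score_def score_def node_resid_def)

lemma gamma_hat_is_l1_min:
  assumes "0 < lam"
  shows "l1_min n {1..<p} X (\<lambda>i. X i 0) lam (gamma_hat n p X lam)"
proof -
  have "j \<notin> {1..<p} \<longleftrightarrow> j = 0 \<or> p \<le> j" for j by auto
  then have "l1_min n {1..<p} X (\<lambda>i. X i 0) lam b \<longleftrightarrow> (\<forall>j. j = 0 \<or> p \<le> j \<longrightarrow> b j = 0) \<and>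
      (\<forall>b'. (\<forall>j. j = 0 \<or> p \<le> j \<longrightarrow> b' j = 0) \<longrightarrow> node_obj n p X lam b \<le> node_obj n p X lam b')" for b
    by (simp add: l1_min_def l1_obj_def node_obj_def l1norm_def resid_def[abs_def] fit_def
        del: atLeastLessThan_iff)
  then show ?thesis
    using someI_ex[OF l1_min_exists[of "{1..<p}" lam n X "\<lambda>i. X i 0"]] assms
    unfolding gamma_hat_def by simp
qed

lemma tau_tilde_sq_eq: "tau_tilde_sq n p X lam = sqn n (node_resid n p X lam) / real n"
  by (simp add: tau_tilde_sq_def node_resid_def resid_def[abs_def] fit_def)

lemma tau_hat_sq_eq_node_score:
  assumes "0 < lam"
  shows "tau_hat_sq n p X lam = node_score n p X lam 0"
  using l1_min_dotn_resid[OF _ gamma_hat_is_l1_min[OF assms]] assms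
  by (simp add: tau_hat_sq_def tau_tilde_sq_eq node_score_eq node_resid_def l1norm_def)

lemma abs_node_score_le:
  assumes "0 < lam" "0 < j" "j < p"
  shows "\<bar>node_score n p X lam j\<bar> \<le> lam"
  unfolding node_score_def
  using assms by (intro l1_min_abs_score_le gamma_hat_is_l1_min) auto

lemma tau_tilde_sq_le_tau_hat_sq: "0 \<le> lam \<Longrightarrow> tau_tilde_sq n p X lam \<le> tau_hat_sq n p X lam"
  by (simp add: tau_hat_sq_def sum_nonneg)

lemma sum_lessThan_split_0: "0 < p \<Longrightarrow> (\<Sum>j<p. f j) = f 0 + (\<Sum>j\<in>{1..<p}. f j)" for f :: "nat \<Rightarrow> real"
  by (simp add: lessThan_atLeast0 sum.atLeast_Suc_lessThan)

lemma mv_node_coef: "0 < p \<Longrightarrow> mv p X (node_coef n p X lam) = node_resid n p X lam"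
  by (rule ext) (simp add: mv_def sum_lessThan_split_0 node_coef_def node_resid_def resid_def fit_def sum_negf)

lemma mv_Theta_hat:
  assumes "0 < p"
  shows "mv p X (Theta_hat n p X lam) i = node_resid n p X lam i / tau_hat_sq n p X lam"
proof -
  have "Theta_hat n p X lam = (\<lambda>j. node_coef n p X lam j / tau_hat_sq n p X lam)"
    by (simp add: Theta_hat_def node_coef_def)
  then show ?thesis
    unfolding mv_node_coef[OF assms, symmetric] by (simp add: mv_def sum_divide_distrib)
qed

lemma tau_tilde_sq_ge_phi_min:
  assumes n: "0 < n" and p: "0 < p" and lam: "0 < lam" and m: "0 < m" "m \<le> s"
    and C: "phi_max n p X s \<le> C" "C^2 < real m * lam^2" and phi: "0 \<le> phi_min n p X m"
  shows "phi_min n p X m \<le> tau_tilde_sq n p X lam"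
proof -
  let ?g = "gamma_hat n p X lam" and ?z = "node_coef n p X lam"
  have g: "l1_min n {1..<p} X (\<lambda>i. X i 0) lam ?g"
    by (rule gamma_hat_is_l1_min[OF lam])
  have column: "sqn n (\<lambda>i. X i 0) / real n \<le> C"
    using sqn_column_le_phi_max[of 0 p s n X] p m C(1) by simp
  moreover have "0 \<le> C"
    using order_trans[OF divide_nonneg_nonneg column] by simp
  ultimately have "card {j\<in>{1..<p}. ?g j \<noteq> 0} < m"
    using C by (intro l1_min_card_active_less[OF g lam _ m _ C(1) column]) (auto simp: power2_eq_square)
  moreover have "{j. j < p \<and> ?z j \<noteq> 0} = insert 0 {j\<in>{1..<p}. ?g j \<noteq> 0}"
    using p by (auto simp: node_coef_def)
  ultimately have "l0norm p ?z \<le> m" "1 \<le> l0norm p ?z"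
    by (auto simp: l0norm_def)
  moreover have "\<forall>j\<ge>p. ?z j = 0"
    using g p by (auto simp: l1_min_def node_coef_def)
  ultimately have "phi_min n p X m * sqn p ?z \<le> tau_tilde_sq n p X lam"
    using phi_min_le_sqn_mv[of p ?z m n X] n by (simp add: tau_tilde_sq_eq mv_node_coef p)
  moreover have "1 \<le> sqn p ?z"
    unfolding sqn_def sum_lessThan_split_0[OF p] by (simp add: node_coef_def sum_nonneg)
  ultimately show ?thesis
    using mult_left_mono[of 1 "sqn p ?z" "phi_min n p X m"] phi by simp
qed

section \<open>Decomposition of the debiased Lasso\<close>

lemma Sigma_hat_mult:
  "(\<Sum>l<p. Sigma_hat n X j l * v l) = dotn n (\<lambda>i. X i j) (mv p X v) / real n"
  unfolding mv_eq_fit dotn_commute[of n "\<lambda>i. X i j"] dotn_fit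
  by (simp add: Sigma_hat_def dotn_def sum_divide_distrib[symmetric] mult.commute)

lemma Omega_hat_eq_sqn_mv: "Omega_hat n p X lam = sqn n (mv p X (Theta_hat n p X lam)) / real n"
proof -
  let ?T = "Theta_hat n p X lam"
  have "Omega_hat n p X lam = (\<Sum>j<p. ?T j * (\<Sum>l<p. Sigma_hat n X j l * ?T l))"
    by (simp add: Omega_hat_def sum_distrib_left mult.assoc)
  also have "\<dots> = dotn n (mv p X ?T) (mv p X ?T) / real n"
    by (simp only: Sigma_hat_mult mv_eq_fit dotn_fit sum_divide_distrib times_divide_eq_right)
  finally show ?thesis by (simp add: dotn_self)
qed

lemma Omega_hat_bounds:
  assumes p: "0 < p" and lam: "0 \<le> lam" and D: "0 < D" "D \<le> tau_tilde_sq n p X lam"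
  shows "0 \<le> Omega_hat n p X lam" "Omega_hat n p X lam \<le> 1 / D"
proof -
  let ?t = "tau_hat_sq n p X lam" and ?s = "tau_tilde_sq n p X lam"
  show "0 \<le> Omega_hat n p X lam" by (simp add: Omega_hat_eq_sqn_mv)
  have le: "?s \<le> ?t" using lam by (rule tau_tilde_sq_le_tau_hat_sq)
  have "Omega_hat n p X lam = ?s / ?t^2"
    by (simp add: Omega_hat_eq_sqn_mv mv_Theta_hat[OF p] sqn_def tau_tilde_sq_eq power_divide
        sum_divide_distrib[symmetric])
  also have "\<dots> \<le> ?t / ?t^2" using le by (intro divide_right_mono) auto
  also have "\<dots> = 1 / ?t" using D le by (simp add: power2_eq_square)
  also have "\<dots> \<le> 1 / D" using D le by (intro divide_left_mono mult_pos_pos) auto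
  finally show "Omega_hat n p X lam \<le> 1 / D" .
qed

lemma W1_eq_dotn: "W1 n p X e lam = dotn n (mv p X (Theta_hat n p X lam)) e / sqrt (real n)"
  unfolding W1_def mv_eq_fit dotn_fit by (simp add: dotn_def)

lemma Delta1_eq_dotn:
  assumes "0 < p" and d: "\<And>j. d j = beta j - lasso n p X Y lam0 j"
  shows "Delta1 n p X Y beta lam0 lam1
    = sqrt (real n) * (dotn n (mv p X (Theta_hat n p X lam1)) (mv p X d) / real n - d 0)"
proof -
  let ?T = "Theta_hat n p X lam1"
  have "(\<Sum>j<p. ((\<Sum>l<p. Sigma_hat n X j l * ?T l) - (if j = 0 then 1 else 0)) * d j)
      = (\<Sum>j<p. d j * dotn n (\<lambda>i. X i j) (mv p X ?T) / real n) - (\<Sum>j<p. if j = 0 then d j else 0)"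
    unfolding Sigma_hat_mult sum_subtractf[symmetric] by (intro sum.cong) (auto simp: algebra_simps)
  also have "\<dots> = dotn n (mv p X d) (mv p X ?T) / real n - d 0"
    using assms(1) by (simp add: mv_eq_fit[of p X] dotn_fit sum_divide_distrib)
  finally show ?thesis
    by (simp add: Delta1_def d[symmetric] dotn_commute)
qed

lemma debiased1_decomposition:
  assumes Y: "\<And>i. i < n \<Longrightarrow> Y i = mv p X beta i + e i" and p: "0 < p"
  shows "sqrt (real n) * (debiased1 n p X Y lam0 lam1 - beta 0)
    = W1 n p X e lam1 + Delta1 n p X Y beta lam0 lam1"
proof -
  let ?u = "mv p X (Theta_hat n p X lam1)" and ?b = "lasso n p X Y lam0"
  define d where "d j = beta j - ?b j" for j
  have "dotn n ?u (\<lambda>i. Y i - mv p X ?b i) = dotn n ?u (\<lambda>i. e i + mv p X d i)"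
    unfolding dotn_def
    by (intro sum.cong) (simp_all add: Y mv_def d_def algebra_simps sum_subtractf)
  then have "debiased1 n p X Y lam0 lam1 - beta 0 = dotn n ?u e / real n + (dotn n ?u (mv p X d) / real n - d 0)"
    by (simp add: debiased1_def mv_eq_fit dotn_fit[symmetric] dotn_def[of n "\<lambda>i. X i _", symmetric]
        dotn_add_right d_def add_divide_distrib)
  moreover have "sqrt (real n) * (x / real n) = x / sqrt (real n)" for x
    by (cases "n = 0") (simp_all add: field_simps)
  ultimately show ?thesis
    by (simp add: W1_eq_dotn Delta1_eq_dotn[OF p d_def] distrib_left)
qed

lemma Sigma_hat_Theta_hat_close:
  assumes lam: "0 < lam" and j: "j < p" and tau: "0 < tau_hat_sq n p X lam"
  shows "\<bar>(\<Sum>l<p. Sigma_hat n X j l * Theta_hat n p X lam l) - (if j = 0 then 1 else 0)\<bar>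
    \<le> lam / tau_hat_sq n p X lam"
proof -
  have "0 < p" using j by simp
  then have "(\<Sum>l<p. Sigma_hat n X j l * Theta_hat n p X lam l) = node_score n p X lam j / tau_hat_sq n p X lam"
    by (simp add: Sigma_hat_mult node_score_eq dotn_def mv_Theta_hat sum_divide_distrib mult.commute)
  then show ?thesis
    using tau lam j abs_node_score_le[OF lam _ j, of n X] tau_hat_sq_eq_node_score[OF lam, of n p X]
    by (auto simp: divide_right_mono)
qed

lemma abs_Delta1_le:
  assumes lam: "0 < lam1" and D: "0 < D" "D \<le> tau_tilde_sq n p X lam1"
  shows "\<bar>Delta1 n p X Y beta lam0 lam1\<bar>
    \<le> sqrt (real n) * lam1 / D * l1norm {..<p} (\<lambda>j. lasso n p X Y lam0 j - beta j)"
proof -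
  let ?a = "\<lambda>j. (\<Sum>l<p. Sigma_hat n X j l * Theta_hat n p X lam1 l) - (if j = 0 then 1 else 0)"
  have tau: "D \<le> tau_hat_sq n p X lam1"
    using order_trans[OF D(2) tau_tilde_sq_le_tau_hat_sq] lam by simp
  have "\<bar>?a j\<bar> \<le> lam1 / D" if "j < p" for j
  proof -
    have "\<bar>?a j\<bar> \<le> lam1 / tau_hat_sq n p X lam1"
      using D(1) tau by (intro Sigma_hat_Theta_hat_close lam that) simp
    also have "\<dots> \<le> lam1 / D"
      using lam D(1) tau by (intro divide_left_mono) auto
    finally show ?thesis .
  qed
  then have "\<bar>\<Sum>j<p. (lasso n p X Y lam0 j - beta j) * ?a j\<bar>
      \<le> lam1 / D * l1norm {..<p} (\<lambda>j. lasso n p X Y lam0 j - beta j)"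
    by (intro abs_sum_mult_le_l1norm) simp
  moreover have "(\<Sum>j<p. (lasso n p X Y lam0 j - beta j) * ?a j) = - (\<Sum>j<p. ?a j * (beta j - lasso n p X Y lam0 j))"
    by (simp add: sum_negf[symmetric] algebra_simps)
  ultimately have "\<bar>\<Sum>j<p. ?a j * (beta j - lasso n p X Y lam0 j)\<bar>
      \<le> lam1 / D * l1norm {..<p} (\<lambda>j. lasso n p X Y lam0 j - beta j)"
    by simp
  from mult_left_mono[OF this, of "sqrt (real n)"] show ?thesis
    by (simp add: Delta1_def abs_mult mult.assoc)
qed

section \<open>Measurability of the penalised fit\<close>

definition near_min_over_rationals ::
    "nat \<Rightarrow> 'i set \<Rightarrow> (nat \<Rightarrow> 'i \<Rightarrow> real) \<Rightarrow> (nat \<Rightarrow> real) \<Rightarrow> real \<Rightarrow> real \<Rightarrow> ('i \<Rightarrow> real) \<Rightarrow> bool" where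
  "near_min_over_rationals n J X Y lam e q \<longleftrightarrow>
     (\<forall>q'\<in>PiE J (\<lambda>_. \<rat>). l1_obj n J X Y lam q \<le> l1_obj n J X Y lam q' + e)"

lemma rational_vector_sequence:
  obtains q where "\<And>m. q m \<in> PiE J (\<lambda>_. \<rat>)" and "\<And>j. j \<in> J \<Longrightarrow> (\<lambda>m. q m j) \<longlonglongrightarrow> (b j :: real)"
proof -
  have "\<exists>x\<in>\<rat>. b j < x \<and> x < b j + 1 / real (Suc m)" for j m
    by (rule Rats_dense_in_real) simp
  then obtain x where x: "\<And>j m. x j m \<in> \<rat>" "\<And>j m. b j < x j m" "\<And>j m. x j m < b j + 1 / real (Suc m)"
    by metis
  have "x j \<longlonglongrightarrow> b j" for j
  proof (rule tendsto_sandwich[of "\<lambda>_. b j"])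
    show "(\<lambda>m. b j + 1 / real (Suc m)) \<longlonglongrightarrow> b j"
      using tendsto_add[OF tendsto_const LIMSEQ_Suc[OF lim_1_over_n]] by simp
  qed (use less_imp_le[OF x(2)] less_imp_le[OF x(3)] in auto)
  then show thesis
    using x(1) by (intro that[of "\<lambda>m. \<lambda>j\<in>J. x j m"]) auto
qed

lemma rational_approx_l1_obj_fit:
  assumes "0 < e"
  obtains q where "q \<in> PiE J (\<lambda>_. \<rat>)"
    and "l1_obj n J X Y lam q < l1_obj n J X Y lam b + e" and "fit J X q i < fit J X b i + e"
proof -
  obtain q where q: "\<And>m. q m \<in> PiE J (\<lambda>_. \<rat>)" "\<And>j. j \<in> J \<Longrightarrow> (\<lambda>m. q m j) \<longlonglongrightarrow> b j"
    using rational_vector_sequence by blast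
  have "(\<lambda>m. l1_obj n J X Y lam (q m)) \<longlonglongrightarrow> l1_obj n J X Y lam b" "(\<lambda>m. fit J X (q m) i) \<longlonglongrightarrow> fit J X b i"
    unfolding l1_obj_def sqn_def l1norm_def resid_def fit_def divide_inverse
    using q(2) by (intro tendsto_intros, auto)+
  then have "\<forall>\<^sub>F m in sequentially. l1_obj n J X Y lam (q m) < l1_obj n J X Y lam b + e"
    "\<forall>\<^sub>F m in sequentially. fit J X (q m) i < fit J X b i + e"
    using assms by (simp_all add: order_tendstoD(2))
  then have "\<exists>m. l1_obj n J X Y lam (q m) < l1_obj n J X Y lam b + e \<and> fit J X (q m) i < fit J X b i + e"
    using eventually_happens'[OF _ eventually_conj] by force
  then show thesis using that q(1) by blast
qed

lemma near_min_over_rationals_l1_obj_le: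
  assumes "near_min_over_rationals n J X Y lam e q"
  shows "l1_obj n J X Y lam q \<le> l1_obj n J X Y lam b + e"
proof (rule field_le_epsilon)
  fix d :: real assume "0 < d"
  then obtain q' where "q' \<in> PiE J (\<lambda>_. \<rat>)" "l1_obj n J X Y lam q' < l1_obj n J X Y lam b + d"
    by (rule rational_approx_l1_obj_fit)
  then show "l1_obj n J X Y lam q \<le> l1_obj n J X Y lam b + e + d"
    using assms unfolding near_min_over_rationals_def by fastforce
qed

lemma abs_fit_near_min_over_rationals_diff_le:
  assumes b: "l1_min n J X Y lam b" and lam: "0 \<le> lam" and i: "i < n"
    and q: "near_min_over_rationals n J X Y lam e q"
  shows "\<bar>fit J X q i - fit J X b i\<bar> \<le> sqrt (real n * e)"
proof (rule real_le_rsqrt)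
  have "fit J X (\<lambda>j. q j - b j) k = fit J X q k - fit J X b k" for k
    by (simp add: fit_def right_diff_distrib sum_subtractf)
  then have "\<bar>fit J X q i - fit J X b i\<bar>^2 = (fit J X (\<lambda>j. q j - b j) i)^2" by simp
  also have "\<dots> \<le> sqn n (fit J X (\<lambda>j. q j - b j))"
    unfolding sqn_def using i by (intro member_le_sum) auto
  also have "\<dots> = real n * (sqn n (fit J X (\<lambda>j. q j - b j)) / real n)"
    using i by simp
  also have "\<dots> \<le> real n * e"
    using l1_min_sqn_fit_le[OF b lam, of q] near_min_over_rationals_l1_obj_le[OF q, of b]
    by (intro mult_left_mono) auto
  finally show "\<bar>fit J X q i - fit J X b i\<bar>^2 \<le> real n * e" .
qed

lemma l1_min_fit_le_iff:
  assumes b: "l1_min n J X Y lam b" and lam: "0 \<le> lam" and i: "i < n"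
  shows "fit J X b i \<le> a \<longleftrightarrow> (\<forall>m. \<exists>q\<in>PiE J (\<lambda>_. \<rat>).
    near_min_over_rationals n J X Y lam (1 / real (Suc m)) q \<and> fit J X q i \<le> a + 1 / real (Suc m))"
    (is "_ \<longleftrightarrow> (\<forall>m. ?near m)")
proof
  assume le: "fit J X b i \<le> a"
  show "\<forall>m. ?near m"
  proof
    fix m
    have "0 < 1 / real (Suc m)" by simp
    then obtain q where q: "q \<in> PiE J (\<lambda>_. \<rat>)" "l1_obj n J X Y lam q < l1_obj n J X Y lam b + 1 / real (Suc m)"
        "fit J X q i < fit J X b i + 1 / real (Suc m)"
      by (rule rational_approx_l1_obj_fit)
    then have "near_min_over_rationals n J X Y lam (1 / real (Suc m)) q"
      unfolding near_min_over_rationals_def using l1_min_le[OF b] by (smt (verit))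
    with q le show "?near m" by force
  qed
next
  assume near: "\<forall>m. ?near m"
  have "fit J X b i \<le> a + 1 / real (Suc m) + sqrt (real n * (1 / real (Suc m)))" for m
    using near abs_fit_near_min_over_rationals_diff_le[OF b lam i] by (smt (verit))
  moreover have "(\<lambda>m. a + 1 / real (Suc m) + sqrt (real n * (1 / real (Suc m)))) \<longlonglongrightarrow> a + 0 + sqrt (real n * 0)"
    by (intro tendsto_intros LIMSEQ_Suc[OF lim_1_over_n])
  ultimately show "fit J X b i \<le> a"
    by (intro LIMSEQ_le_const) auto
qed

text \<open>The selection \<open>b\<close> of minimisers need not be measurable.\<close>

lemma l1_min_fit_measurable:
  assumes J: "finite J" and lam: "0 \<le> lam" and i: "i < n"
    and X: "\<And>i j. i < n \<Longrightarrow> j \<in> J \<Longrightarrow> (\<lambda>w. X w i j) \<in> borel_measurable N"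
    and Y: "\<And>i. i < n \<Longrightarrow> (\<lambda>w. Y w i) \<in> borel_measurable N"
    and b: "\<And>w. w \<in> space N \<Longrightarrow> l1_min n J (X w) (Y w) lam (b w)"
  shows "(\<lambda>w. fit J (X w) (b w) i) \<in> borel_measurable N"
proof (rule borel_measurableI_le)
  fix a
  let ?Q = "PiE J (\<lambda>_. \<rat> :: real set)"
  have Q: "countable ?Q" using J by (intro countable_PiE countable_rat)
  have fit_meas: "(\<lambda>w. fit J (X w) q i) \<in> borel_measurable N" if "i < n" for q i
    unfolding fit_def using X[OF that] by measurable
  have obj_meas: "(\<lambda>w. l1_obj n J (X w) (Y w) lam q) \<in> borel_measurable N" for q
    unfolding l1_obj_def sqn_def resid_def using fit_meas Y by measurable
  have "{w \<in> space N. \<forall>q'\<in>?Q. l1_obj n J (X w) (Y w) lam q \<le> l1_obj n J (X w) (Y w) lam q' + e} \<in> sets N" for q e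
    by (intro sets.sets_Collect_countable_All' Q borel_measurable_le borel_measurable_add obj_meas
        borel_measurable_const)
  then have "{w \<in> space N. \<forall>m. \<exists>q\<in>?Q. near_min_over_rationals n J (X w) (Y w) lam (1 / real (Suc m)) q \<and>
      fit J (X w) q i \<le> a + 1 / real (Suc m)} \<in> sets N"
    unfolding near_min_over_rationals_def
    by (intro sets.sets_Collect_countable_All sets.sets_Collect_countable_Ex' sets.sets_Collect_conj
        borel_measurable_le fit_meas i borel_measurable_const Q)
  also have "{w \<in> space N. \<forall>m. \<exists>q\<in>?Q. near_min_over_rationals n J (X w) (Y w) lam (1 / real (Suc m)) q \<and>
      fit J (X w) q i \<le> a + 1 / real (Suc m)} = {w \<in> space N. fit J (X w) (b w) i \<le> a}"
    using l1_min_fit_le_iff[OF b lam i] by blast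
  finally show "{w \<in> space N. fit J (X w) (b w) i \<le> a} \<in> sets N" .
qed

lemma matM_entry_measurable [measurable]: "(\<lambda>X. X i j) \<in> borel_measurable matM"
  unfolding matM_def
  by (rule measurable_compose[OF measurable_component_singleton[of i UNIV] measurable_component_singleton[of j UNIV]]) auto

lemma node_resid_measurable:
  assumes "0 < lam" "i < n"
  shows "(\<lambda>X. node_resid n p X lam i) \<in> borel_measurable matM"
  unfolding node_resid_def resid_def
  using assms by (intro borel_measurable_diff l1_min_fit_measurable[OF _ _ _ _ _ gamma_hat_is_l1_min]) auto

lemma mv_Theta_hat_measurable:
  assumes lam: "0 < lam" and p: "0 < p" and i: "i < n"
  shows "(\<lambda>X. mv p X (Theta_hat n p X lam) i) \<in> borel_measurable matM"
  unfolding mv_Theta_hat[OF p] tau_hat_sq_eq_node_score[OF lam] node_score_eq dotn_def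
  by (intro borel_measurable_divide borel_measurable_sum borel_measurable_times node_resid_measurable
      lam i borel_measurable_const matM_entry_measurable) simp

section \<open>Gaussian noise\<close>

lemma density_PiM:
  assumes I: "finite I" and M: "product_sigma_finite M" "product_sigma_finite (\<lambda>i. density (M i) (f i))"
    and f [measurable]: "\<And>i. i \<in> I \<Longrightarrow> f i \<in> borel_measurable (M i)"
  shows "density (PiM I M) (\<lambda>x. \<Prod>i\<in>I. f i (x i)) = PiM I (\<lambda>i. density (M i) (f i))"
proof (rule product_sigma_finite.PiM_eqI[OF M(2) I])
  show "sets (density (PiM I M) (\<lambda>x. \<Prod>i\<in>I. f i (x i))) = sets (PiM I (\<lambda>i. density (M i) (f i)))"
    by (simp cong: sets_PiM_cong)
  fix A assume "\<And>i. i \<in> I \<Longrightarrow> A i \<in> sets (density (M i) (f i))"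
  then have A [measurable]: "A i \<in> sets (M i)" if "i \<in> I" for i using that by simp
  have [measurable]: "PiE I A \<in> sets (PiM I M)"
    using A I by (intro sets_PiM_I_finite)
  have prod_meas: "(\<lambda>x. \<Prod>i\<in>I. f i (x i)) \<in> borel_measurable (PiM I M)"
    by (intro borel_measurable_prod_ennreal measurable_compose[OF measurable_component_singleton]) auto
  have "emeasure (density (PiM I M) (\<lambda>x. \<Prod>i\<in>I. f i (x i))) (PiE I A)
     = (\<integral>\<^sup>+x. (\<Prod>i\<in>I. f i (x i)) * indicator (PiE I A) x \<partial>PiM I M)"
    by (rule emeasure_density[OF prod_meas]) measurable
  also have "\<dots> = (\<integral>\<^sup>+x. (\<Prod>i\<in>I. f i (x i) * indicator (A i) (x i)) \<partial>PiM I M)"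
  proof (rule nn_integral_cong)
    fix x assume "x \<in> space (PiM I M)"
    then have "indicator (PiE I A) x = (\<Prod>i\<in>I. indicator (A i) (x i) :: ennreal)"
      using I by (auto simp: space_PiM PiE_iff indicator_def prod_zero_iff)
    then show "(\<Prod>i\<in>I. f i (x i)) * indicator (PiE I A) x = (\<Prod>i\<in>I. f i (x i) * indicator (A i) (x i))"
      by (simp add: prod.distrib)
  qed
  also have "\<dots> = (\<Prod>i\<in>I. \<integral>\<^sup>+x. f i x * indicator (A i) x \<partial>M i)"
    by (intro product_sigma_finite.product_nn_integral_prod[OF M(1) I]) measurable
  also have "\<dots> = (\<Prod>i\<in>I. emeasure (density (M i) (f i)) (A i))"
    by (intro prod.cong refl emeasure_density[symmetric]) auto
  finally show "emeasure (density (PiM I M) (\<lambda>x. \<Prod>i\<in>I. f i (x i))) (PiE I A)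
     = (\<Prod>i\<in>I. emeasure (density (M i) (f i)) (A i))" .
qed

context prob_space
begin

context
  fixes I :: "'i set" and N :: "'i \<Rightarrow> 'b measure" and f :: "'i \<Rightarrow> 'b \<Rightarrow> ennreal" and e :: "'i \<Rightarrow> 'a \<Rightarrow> 'b"
  assumes I: "finite I" and N: "product_sigma_finite N" and f: "\<And>i. i \<in> I \<Longrightarrow> f i \<in> borel_measurable (N i)"
    and f_prob: "\<And>i. prob_space (density (N i) (f i))"
    and joint: "distributed M (PiM I N) (\<lambda>\<omega>. \<lambda>i\<in>I. e i \<omega>) (\<lambda>x. \<Prod>i\<in>I. f i (x i))"
begin

lemma distr_product_density: "distr M (PiM I N) (\<lambda>\<omega>. \<lambda>i\<in>I. e i \<omega>) = PiM I (\<lambda>i. density (N i) (f i))"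
proof -
  interpret D: product_prob_space "\<lambda>i. density (N i) (f i)"
    using f_prob by (rule product_prob_spaceI)
  show ?thesis
    using density_PiM[OF I N D.product_sigma_finite_axioms f] joint by (simp add: distributed_def)
qed

lemma distributed_product_density_component:
  assumes i: "i \<in> I"
  shows "distributed M (N i) (e i) (f i)"
proof -
  have E [measurable]: "(\<lambda>\<omega>. \<lambda>i\<in>I. e i \<omega>) \<in> measurable M (PiM I N)"
    using joint by (simp add: distributed_def)
  have e: "e i \<in> measurable M (N i)"
    using measurable_compose[OF E measurable_component_singleton[OF i]] i by simp
  have "distr M (N i) (e i) = distr (distr M (PiM I N) (\<lambda>\<omega>. \<lambda>i\<in>I. e i \<omega>)) (N i) (\<lambda>x. x i)"
    using i by (subst distr_distr) (auto simp: comp_def)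
  also have "\<dots> = distr (PiM I (\<lambda>i. density (N i) (f i))) (density (N i) (f i)) (\<lambda>x. x i)"
    unfolding distr_product_density by (intro distr_cong) auto
  also have "\<dots> = density (N i) (f i)"
    by (rule distr_PiM_component[OF f_prob i])
  finally show ?thesis
    using e f[OF i] by (simp add: distributed_def)
qed

lemma indep_vars_product_density: "indep_vars N e I"
proof (cases "I = {}")
  case True
  then show ?thesis by (simp add: indep_vars_def indep_sets_def)
next
  case False
  have e: "distr M (N i) (e i) = density (N i) (f i)" "random_variable (N i) (e i)" if "i \<in> I" for i
    using distributed_product_density_component[OF that] by (simp_all add: distributed_def)
  have "distr M (PiM I N) (\<lambda>\<omega>. \<lambda>i\<in>I. e i \<omega>) = (\<Pi>\<^sub>M i\<in>I. distr M (N i) (e i))"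
    unfolding distr_product_density by (intro PiM_cong) (simp_all add: e)
  then show ?thesis
    using e by (subst indep_vars_iff_distr_eq_PiM'[OF False]) auto
qed

end

lemma distributed_linear_combination_indep_normal:
  assumes "finite I" "I \<noteq> {}" and indep: "indep_vars (\<lambda>_. lborel) e I"
    and s: "\<And>i. i \<in> I \<Longrightarrow> 0 < s i" and u: "\<And>i. i \<in> I \<Longrightarrow> u i \<noteq> 0"
    and normal: "\<And>i. i \<in> I \<Longrightarrow> distributed M lborel (e i) (normal_density 0 (s i))"
  shows "distributed M lborel (\<lambda>\<omega>. \<Sum>i\<in>I. u i * e i \<omega>) (normal_density 0 (sqrt (\<Sum>i\<in>I. (u i * s i)^2)))"
proof -
  have "indep_vars (\<lambda>_. borel) (\<lambda>i \<omega>. u i * e i \<omega>) I"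
    by (rule indep_vars_compose2[where Y = "\<lambda>i x. u i * x", OF indep]) auto
  then have "distributed M lborel (\<lambda>\<omega>. \<Sum>i\<in>I. u i * e i \<omega>)
    (normal_density (\<Sum>i\<in>I. 0) (sqrt (\<Sum>i\<in>I. (\<bar>u i\<bar> * s i)^2)))"
  proof (rule sum_indep_normal[OF assms(1,2)])
    fix i assume i: "i \<in> I"
    then show "0 < \<bar>u i\<bar> * s i" using s u by simp
    show "distributed M lborel (\<lambda>\<omega>. u i * e i \<omega>) (normal_density 0 (\<bar>u i\<bar> * s i))"
      using normal_density_affine[OF normal[OF i] s[OF i] u[OF i], of 0] by simp
  qed
  then show ?thesis by (simp add: power_mult_distrib)
qed

lemma distr_linear_combination_indep_normal:
  assumes "finite I" and indep: "indep_vars (\<lambda>_. lborel) e I"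
    and s: "\<And>i. i \<in> I \<Longrightarrow> 0 < s i"
    and normal: "\<And>i. i \<in> I \<Longrightarrow> distributed M lborel (e i) (normal_density 0 (s i))"
  shows "distr M borel (\<lambda>\<omega>. \<Sum>i\<in>I. u i * e i \<omega>) = normal_law (\<Sum>i\<in>I. (u i * s i)^2)"
proof -
  define J where "J = {i\<in>I. u i \<noteq> 0}"
  have J: "finite J" "J \<subseteq> I" using assms(1) by (auto simp: J_def)
  have sums: "(\<Sum>i\<in>I. u i * e i \<omega>) = (\<Sum>i\<in>J. u i * e i \<omega>)" "(\<Sum>i\<in>I. (u i * s i)^2) = (\<Sum>i\<in>J. (u i * s i)^2)" for \<omega>
    using assms(1) by (auto intro!: sum.mono_neutral_right simp: J_def)
  show ?thesis
  proof (cases "J = {}")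
    case True
    then show ?thesis
      unfolding sums by (simp add: normal_law_def distr_const)
  next
    case False
    have "distributed M lborel (\<lambda>\<omega>. \<Sum>i\<in>J. u i * e i \<omega>) (normal_density 0 (sqrt (\<Sum>i\<in>J. (u i * s i)^2)))"
      using J(2) by (intro distributed_linear_combination_indep_normal J(1) False
          indep_vars_subset[OF indep] s normal) (auto simp: J_def)
    moreover have "distr M borel (\<lambda>\<omega>. \<Sum>i\<in>J. u i * e i \<omega>) = distr M lborel (\<lambda>\<omega>. \<Sum>i\<in>J. u i * e i \<omega>)"
      by (intro distr_cong) auto
    moreover have "0 < (\<Sum>i\<in>J. (u i * s i)^2)"
    proof (rule sum_pos[OF J(1) False])
      show "0 < (u i * s i)^2" if "i \<in> J" for i
        using that s[of i] by (simp add: J_def)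
    qed
    ultimately show ?thesis
      unfolding sums by (simp add: normal_law_def distributed_def)
  qed
qed

context
  fixes S :: "'b measure" and T :: "'c measure" and X :: "'a \<Rightarrow> 'b" and Z :: "'a \<Rightarrow> 'c"
  assumes X: "X \<in> measurable M S" and Z: "Z \<in> measurable M T"
    and indep: "indep_set {X -` A \<inter> space M | A. A \<in> sets S} {Z -` B \<inter> space M | B. B \<in> sets T}"
begin

lemma distr_pair_indep_set:
  "distr M (S \<Otimes>\<^sub>M T) (\<lambda>\<omega>. (X \<omega>, Z \<omega>)) = distr M S X \<Otimes>\<^sub>M distr M T Z"
proof (rule pair_measure_eqI[symmetric])
  interpret X: prob_space "distr M S X" by (rule prob_space_distr[OF X])
  interpret Z: prob_space "distr M T Z" by (rule prob_space_distr[OF Z])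
  show "sigma_finite_measure (distr M S X)" "sigma_finite_measure (distr M T Z)" by unfold_locales
  show "sets (distr M S X \<Otimes>\<^sub>M distr M T Z) = sets (distr M (S \<Otimes>\<^sub>M T) (\<lambda>\<omega>. (X \<omega>, Z \<omega>)))"
    by (simp cong: sets_pair_measure_cong)
  fix A B assume "A \<in> sets (distr M S X)" "B \<in> sets (distr M T Z)"
  then have A: "A \<in> sets S" and B: "B \<in> sets T" by auto
  have "prob (X -` A \<inter> space M) * prob (Z -` B \<inter> space M) = prob ((X -` A \<inter> space M) \<inter> (Z -` B \<inter> space M))"
    using A B by (intro indep_setD[OF indep, symmetric]) auto
  also have "(X -` A \<inter> space M) \<inter> (Z -` B \<inter> space M) = (\<lambda>\<omega>. (X \<omega>, Z \<omega>)) -` (A \<times> B) \<inter> space M"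
    by auto
  finally show "emeasure (distr M S X) A * emeasure (distr M T Z) B
      = emeasure (distr M (S \<Otimes>\<^sub>M T) (\<lambda>\<omega>. (X \<omega>, Z \<omega>))) (A \<times> B)"
    using X Z A B by (simp add: emeasure_distr emeasure_eq_measure ennreal_mult[symmetric])
qed

lemma
  assumes Q: "Q \<in> sets (S \<Otimes>\<^sub>M T)"
  shows prob_slice_measurable: "(\<lambda>x. prob {\<omega>\<in>space M. (x, Z \<omega>) \<in> Q}) \<in> borel_measurable S"
    and prob_pair_eq_integral_slice:
      "prob {\<omega>\<in>space M. (X \<omega>, Z \<omega>) \<in> Q} = (\<integral>\<omega>. prob {\<omega>'\<in>space M. (X \<omega>, Z \<omega>') \<in> Q} \<partial>M)"
proof -
  interpret Z: prob_space "distr M T Z" by (rule prob_space_distr[OF Z])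
  have slice: "emeasure (distr M T Z) (Pair x -` Q) = prob {\<omega>\<in>space M. (x, Z \<omega>) \<in> Q}" for x
    using emeasure_distr[OF Z sets_Pair1[OF Q, of x]]
    by (simp add: emeasure_eq_measure vimage_def Int_def conj_commute)
  have "(\<lambda>x. emeasure (distr M T Z) (Pair x -` Q)) \<in> borel_measurable S"
    using Q by (intro Z.measurable_emeasure_Pair) (simp cong: sets_pair_measure_cong)
  then have slice_meas: "(\<lambda>x. ennreal (prob {\<omega>\<in>space M. (x, Z \<omega>) \<in> Q})) \<in> borel_measurable S"
    by (simp only: slice)
  from borel_measurable_enn2real[OF this]
  show meas: "(\<lambda>x. prob {\<omega>\<in>space M. (x, Z \<omega>) \<in> Q}) \<in> borel_measurable S" by simp
  have "ennreal (prob {\<omega>\<in>space M. (X \<omega>, Z \<omega>) \<in> Q}) = emeasure (distr M (S \<Otimes>\<^sub>M T) (\<lambda>\<omega>. (X \<omega>, Z \<omega>))) Q"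
    using X Z Q by (simp add: emeasure_distr emeasure_eq_measure vimage_def Int_def conj_commute)
  also have "\<dots> = (\<integral>\<^sup>+x. emeasure (distr M T Z) (Pair x -` Q) \<partial>distr M S X)"
    unfolding distr_pair_indep_set
    using Q by (intro Z.emeasure_pair_measure_alt) (simp cong: sets_pair_measure_cong)
  also have "\<dots> = (\<integral>\<^sup>+\<omega>. ennreal (prob {\<omega>'\<in>space M. (X \<omega>, Z \<omega>') \<in> Q}) \<partial>M)"
    unfolding slice using X slice_meas by (subst nn_integral_distr) auto
  also have "\<dots> = ennreal (\<integral>\<omega>. prob {\<omega>'\<in>space M. (X \<omega>, Z \<omega>') \<in> Q} \<partial>M)"
    by (intro nn_integral_eq_integral integrable_const_bound[of _ 1] measurable_compose[OF X meas]) auto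
  finally show "prob {\<omega>\<in>space M. (X \<omega>, Z \<omega>) \<in> Q} = (\<integral>\<omega>. prob {\<omega>'\<in>space M. (X \<omega>, Z \<omega>') \<in> Q} \<partial>M)"
    by (simp add: integral_nonneg_AE)
qed

end

end

lemma normal_density_le_tilted:
  assumes s: "0 < s" and t: "0 \<le> t" "t < \<bar>x\<bar>"
  shows "normal_density 0 s x \<le> exp (- (t^2) / (2 * s^2)) * (normal_density t s x + normal_density (- t) s x)"
proof -
  define m where "m = sgn x * t"
  have "t * t \<le> t * \<bar>x\<bar>" using t by (intro mult_left_mono) auto
  then have "t^2 + (x - m)^2 \<le> x^2"
    using t by (auto simp: m_def sgn_if power2_eq_square algebra_simps abs_if split: if_splits)
  then have "exp (- (x^2) / (2 * s^2)) \<le> exp (- (t^2) / (2 * s^2) + - ((x - m)^2) / (2 * s^2))"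
    using s by (simp add: field_simps)
  then have "normal_density 0 s x \<le> exp (- (t^2) / (2 * s^2)) * normal_density m s x"
    unfolding normal_density_def using s by (simp add: exp_add[symmetric] divide_right_mono)
  also have "normal_density m s x \<le> normal_density t s x + normal_density (- t) s x"
    using normal_density_nonneg[of t s x] normal_density_nonneg[of "- t" s x] t by (auto simp: m_def sgn_if)
  finally show ?thesis by simp
qed

lemma normal_law_tail:
  assumes t: "0 \<le> t" and V: "0 < V" "v \<le> V"
  shows "measure (normal_law v) {x. t < \<bar>x\<bar>} \<le> 2 * exp (- (t^2) / (2 * V))"
proof (cases "v \<le> 0")
  case True
  then have "measure (normal_law v) {x. t < \<bar>x\<bar>} = 0"
    using t by (simp add: normal_law_def measure_return)
  then show ?thesis by simp
next
  case False
  define s where "s = sqrt v"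
  have s: "0 < s" "s^2 = v" using False by (auto simp: s_def)
  let ?D = "density lborel (normal_density 0 s)" and ?tail = "{x. t < \<bar>x\<bar>}"
  interpret D: prob_space ?D by (rule prob_space_normal_density[OF s(1)])
  have "measure (normal_law v) ?tail = (\<integral>x. indicator ?tail x \<partial>?D)"
    using False by (simp add: normal_law_def s_def)
  also have "\<dots> = (\<integral>x. normal_density 0 s x * indicator ?tail x \<partial>lborel)"
    by (rule integral_real_density) auto
  also have "\<dots> \<le> (\<integral>x. exp (- (t^2) / (2 * v)) * (normal_density t s x + normal_density (- t) s x) \<partial>lborel)"
  proof (rule integral_mono)
    show "integrable lborel (\<lambda>x. normal_density 0 s x * indicator ?tail x)"
      using s by (intro integrable_real_mult_indicator) auto
    show "normal_density 0 s x * indicator ?tail x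
        \<le> exp (- (t^2) / (2 * v)) * (normal_density t s x + normal_density (- t) s x)" for x
      using normal_density_le_tilted[OF s(1) t, of x] s(2) by (auto simp: indicator_def)
  qed (use s in auto)
  also have "\<dots> = 2 * exp (- (t^2) / (2 * v))"
    using s by simp
  also have "\<dots> \<le> 2 * exp (- (t^2) / (2 * V))"
    using V False by (simp add: frac_le)
  finally show ?thesis .
qed

locale gaussian_noise = prob_space M for M :: "'a measure" +
  fixes S :: "'x measure" and X :: "'a \<Rightarrow> 'x" and n :: nat and e :: "'a \<Rightarrow> nat \<Rightarrow> real" and sigma :: real
  assumes sigma_pos: "0 < sigma"
    and noise_indep: "indep_vars (\<lambda>_. lborel) (\<lambda>i \<omega>. e \<omega> i) {..<n}"
    and noise_normal: "\<And>i. i < n \<Longrightarrow> distributed M lborel (\<lambda>\<omega>. e \<omega> i) (normal_density 0 sigma)"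
    and design_measurable: "X \<in> measurable M S"
    and design_indep: "indep_set {X -` B \<inter> space M | B. B \<in> sets S}
      {(\<lambda>\<omega>. restrict (e \<omega>) {..<n}) -` E \<inter> space M | E. E \<in> sets (PiM {..<n} (\<lambda>_. borel :: real measure))}"
begin

lemma noise_measurable: "i < n \<Longrightarrow> (\<lambda>\<omega>. e \<omega> i) \<in> borel_measurable M"
  using noise_normal by (auto simp: distributed_def)

lemma noise_vector_measurable:
  "(\<lambda>\<omega>. restrict (e \<omega>) {..<n}) \<in> measurable M (PiM {..<n} (\<lambda>_. borel))"
  by (intro measurable_restrict noise_measurable) simp

lemma dotn_noise_law: "distr M borel (\<lambda>\<omega>. dotn n c (e \<omega>)) = normal_law (sigma^2 * sqn n c)"
  using distr_linear_combination_indep_normal[OF _ noise_indep sigma_pos noise_normal, of c]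
  by (simp add: dotn_def sqn_def power_mult_distrib sum_distrib_left mult.commute)

context
  fixes u :: "'x \<Rightarrow> nat \<Rightarrow> real" and A :: "real set" and B :: "'x set"
  assumes u: "\<And>i. i < n \<Longrightarrow> (\<lambda>x. u x i) \<in> borel_measurable S"
    and A [measurable]: "A \<in> sets borel" and B [measurable]: "B \<in> sets S"
begin

lemma dotn_design_noise_measurable: "(\<lambda>\<omega>. dotn n (u (X \<omega>)) (e \<omega>)) \<in> borel_measurable M"
  unfolding dotn_def
  by (intro borel_measurable_sum borel_measurable_times noise_measurable
      measurable_compose[OF design_measurable u]) auto

lemma
  shows normal_law_design_measurable:
      "(\<lambda>x. indicator B x * measure (normal_law (sigma^2 * sqn n (u x))) A) \<in> borel_measurable S"
    and prob_dotn_design_noise: "prob {\<omega>\<in>space M. X \<omega> \<in> B \<and> dotn n (u (X \<omega>)) (e \<omega>) \<in> A}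
      = (\<integral>\<omega>. indicator B (X \<omega>) * measure (normal_law (sigma^2 * sqn n (u (X \<omega>)))) A \<partial>M)"
proof -
  let ?T = "PiM {..<n} (\<lambda>_. borel :: real measure)"
  define Q where "Q = {w \<in> space (S \<Otimes>\<^sub>M ?T). fst w \<in> B \<and> dotn n (u (fst w)) (snd w) \<in> A}"
  have "(\<lambda>w. dotn n (u (fst w)) (snd w)) \<in> borel_measurable (S \<Otimes>\<^sub>M ?T)"
    unfolding dotn_def
    by (intro borel_measurable_sum borel_measurable_times measurable_compose[OF measurable_fst u]
        measurable_compose[OF measurable_snd measurable_component_singleton]) auto
  then have Q: "Q \<in> sets (S \<Otimes>\<^sub>M ?T)"
    unfolding Q_def by measurable
  have mem_Q: "(x, restrict (e \<omega>) {..<n}) \<in> Q \<longleftrightarrow> x \<in> B \<and> dotn n (u x) (e \<omega>) \<in> A" for x \<omega>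
    using sets.sets_into_space[OF B] by (auto simp: Q_def space_pair_measure space_PiM dotn_def)
  have "prob {\<omega>\<in>space M. dotn n c (e \<omega>) \<in> A} = measure (normal_law (sigma^2 * sqn n c)) A" for c
  proof -
    have "(\<lambda>\<omega>. dotn n c (e \<omega>)) \<in> borel_measurable M"
      unfolding dotn_def using noise_measurable by measurable
    then show ?thesis
      unfolding dotn_noise_law[symmetric] by (simp add: measure_distr vimage_def Int_def conj_commute)
  qed
  then have slice: "prob {\<omega>\<in>space M. (x, restrict (e \<omega>) {..<n}) \<in> Q}
      = indicator B x * measure (normal_law (sigma^2 * sqn n (u x))) A" for x
    by (cases "x \<in> B") (simp_all add: mem_Q)
  show "(\<lambda>x. indicator B x * measure (normal_law (sigma^2 * sqn n (u x))) A) \<in> borel_measurable S"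
    using prob_slice_measurable[OF design_measurable noise_vector_measurable design_indep Q] by (simp only: slice)
  show "prob {\<omega>\<in>space M. X \<omega> \<in> B \<and> dotn n (u (X \<omega>)) (e \<omega>) \<in> A}
      = (\<integral>\<omega>. indicator B (X \<omega>) * measure (normal_law (sigma^2 * sqn n (u (X \<omega>)))) A \<partial>M)"
    using prob_pair_eq_integral_slice[OF design_measurable noise_vector_measurable design_indep Q]
    unfolding slice by (simp only: mem_Q)
qed

end

lemma dotn_design_noise_tail:
  assumes u: "\<And>i. i < n \<Longrightarrow> (\<lambda>x. u x i) \<in> borel_measurable S" and t: "0 \<le> t" and V: "0 < V"
  shows "prob {\<omega>\<in>space M. sqn n (u (X \<omega>)) \<le> V \<and> t < \<bar>dotn n (u (X \<omega>)) (e \<omega>)\<bar>}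
    \<le> 2 * exp (- (t^2) / (2 * (sigma^2 * V)))"
proof -
  define B where "B = {x\<in>space S. sqn n (u x) \<le> V}"
  have B: "B \<in> sets S" unfolding B_def sqn_def using u by measurable
  let ?tail = "{x::real. t < \<bar>x\<bar>}"
  let ?law = "\<lambda>x. measure (normal_law (sigma^2 * sqn n (u x))) ?tail"
  have tail: "?tail \<in> sets borel" by measurable
  have "prob {\<omega>\<in>space M. sqn n (u (X \<omega>)) \<le> V \<and> t < \<bar>dotn n (u (X \<omega>)) (e \<omega>)\<bar>}
      = prob {\<omega>\<in>space M. X \<omega> \<in> B \<and> dotn n (u (X \<omega>)) (e \<omega>) \<in> ?tail}"
    using measurable_space[OF design_measurable] by (auto simp: B_def intro!: arg_cong[of _ _ prob])
  also have "\<dots> = (\<integral>\<omega>. indicator B (X \<omega>) * ?law (X \<omega>) \<partial>M)"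
    by (rule prob_dotn_design_noise[OF u tail B])
  also have "\<dots> \<le> 2 * exp (- (t^2) / (2 * (sigma^2 * V)))"
  proof (rule integral_le_const)
    have "?law x \<le> 2 * exp (- (t^2) / (2 * (sigma^2 * V)))" if "x \<in> B" for x
      using sigma_pos V that by (intro normal_law_tail t mult_left_mono) (auto simp: B_def)
    then have bound: "indicator B x * ?law x \<le> 2 * exp (- (t^2) / (2 * (sigma^2 * V)))" for x
      by (simp add: indicator_def)
    then show "AE \<omega> in M. indicator B (X \<omega>) * ?law (X \<omega>) \<le> 2 * exp (- (t^2) / (2 * (sigma^2 * V)))"
      by simp
    show "integrable M (\<lambda>\<omega>. indicator B (X \<omega>) * ?law (X \<omega>))"
      using bound
      by (intro integrable_const_bound[of _ "2 * exp (- (t^2) / (2 * (sigma^2 * V)))"]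
          measurable_compose[OF design_measurable normal_law_design_measurable[OF u tail B]]) auto
  qed
  finally show ?thesis .
qed

lemma
  assumes J: "finite J" and t: "0 \<le> t" and V: "0 < V"
    and u: "\<And>i j. i < n \<Longrightarrow> j \<in> J \<Longrightarrow> (\<lambda>x. u j x i) \<in> borel_measurable S"
  defines "exceed_any \<equiv> {\<omega>\<in>space M. \<exists>j\<in>J. sqn n (u j (X \<omega>)) \<le> V \<and> t < \<bar>dotn n (u j (X \<omega>)) (e \<omega>)\<bar>}"
  shows dotn_design_noise_union_sets: "exceed_any \<in> events"
    and dotn_design_noise_union_bound: "prob exceed_any \<le> real (card J) * (2 * exp (- (t^2) / (2 * (sigma^2 * V))))"
proof -
  define exceed where "exceed j = {\<omega>\<in>space M. sqn n (u j (X \<omega>)) \<le> V \<and> t < \<bar>dotn n (u j (X \<omega>)) (e \<omega>)\<bar>}" for j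
  have exceed: "exceed j \<in> events" if "j \<in> J" for j
  proof -
    have "(\<lambda>\<omega>. dotn n (u j (X \<omega>)) (e \<omega>)) \<in> borel_measurable M" "(\<lambda>\<omega>. sqn n (u j (X \<omega>))) \<in> borel_measurable M"
      using u that dotn_design_noise_measurable
      by (auto simp: sqn_def intro!: borel_measurable_sum borel_measurable_power measurable_compose[OF design_measurable u])
    then show ?thesis unfolding exceed_def by measurable
  qed
  have exceed_any_eq: "exceed_any = (\<Union>j\<in>J. exceed j)"
    by (auto simp: exceed_any_def exceed_def)
  show "exceed_any \<in> events" unfolding exceed_any_eq using J exceed by auto
  have "prob exceed_any \<le> (\<Sum>j\<in>J. prob (exceed j))"
    unfolding exceed_any_eq using J exceed by (intro finite_measure_subadditive_finite) auto
  also have "\<dots> \<le> real (card J) * (2 * exp (- (t^2) / (2 * (sigma^2 * V))))"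
    unfolding exceed_def by (intro sum_bounded_above dotn_design_noise_tail t V u)
  finally show "prob exceed_any \<le> real (card J) * (2 * exp (- (t^2) / (2 * (sigma^2 * V))))" .
qed

end

lemma gaussian_noiseI:
  fixes e :: "'a \<Rightarrow> nat \<Rightarrow> real" and sigma :: real
  assumes "prob_space M" and sigma: "0 < sigma" and X: "X \<in> measurable M S"
    and noise: "distributed M (PiM {..<n} (\<lambda>_. lborel)) (\<lambda>\<omega>. restrict (e \<omega>) {..<n})
      (\<lambda>x. ennreal (\<Prod>i<n. normal_density 0 sigma (x i)))"
    and indep: "prob_space.indep_set M {X -` B \<inter> space M | B. B \<in> sets S}
      {(\<lambda>\<omega>. restrict (e \<omega>) {..<n}) -` E \<inter> space M | E. E \<in> sets (PiM {..<n} (\<lambda>_. borel :: real measure))}"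
  shows "gaussian_noise M S X n e sigma"
proof -
  interpret prob_space M by fact
  interpret L: product_sigma_finite "\<lambda>_. lborel :: real measure" by standard
  have joint: "distributed M (PiM {..<n} (\<lambda>_. lborel)) (\<lambda>\<omega>. restrict (e \<omega>) {..<n})
      (\<lambda>x. \<Prod>i<n. ennreal (normal_density 0 sigma (x i)))"
    using noise by (simp add: prod_ennreal)
  note product_density = finite_lessThan L.product_sigma_finite_axioms _ prob_space_normal_density[OF sigma] joint
  show ?thesis
  proof
    show "indep_vars (\<lambda>_. lborel) (\<lambda>i \<omega>. e \<omega> i) {..<n}"
      by (rule indep_vars_product_density[OF product_density]) auto
    show "distributed M lborel (\<lambda>\<omega>. e \<omega> i) (normal_density 0 sigma)" if "i < n" for i
      by (rule distributed_product_density_component[OF product_density]) (use that in auto)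
  qed (rule sigma X indep)+
qed

section \<open>Convergence in probability\<close>

lemma whp_mono:
  assumes P: "whp M P" and PQ: "\<forall>\<^sub>F k in sequentially. \<forall>\<omega>\<in>space (M k). P k \<omega> \<longrightarrow> Q k \<omega>"
  shows "whp M Q"
  unfolding whp_def
proof (intro allI impI)
  fix d :: real assume "0 < d"
  then have "\<forall>\<^sub>F k in sequentially. \<exists>E\<in>sets (M k). E \<subseteq> {\<omega>\<in>space (M k). P k \<omega>} \<and> measure (M k) E \<ge> 1 - d"
    using P by (simp add: whp_def)
  with PQ show "\<forall>\<^sub>F k in sequentially. \<exists>E\<in>sets (M k). E \<subseteq> {\<omega>\<in>space (M k). Q k \<omega>} \<and> measure (M k) E \<ge> 1 - d"
    by eventually_elim blast
qed

lemma whp_conj: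
  assumes prob: "\<And>k. prob_space (M k)" and P: "whp M P" and Q: "whp M Q"
  shows "whp M (\<lambda>k \<omega>. P k \<omega> \<and> Q k \<omega>)"
  unfolding whp_def
proof (intro allI impI)
  fix d :: real assume "0 < d"
  then have "\<forall>\<^sub>F k in sequentially. \<exists>E\<in>sets (M k). E \<subseteq> {\<omega>\<in>space (M k). P k \<omega>} \<and> measure (M k) E \<ge> 1 - d / 2"
    "\<forall>\<^sub>F k in sequentially. \<exists>E\<in>sets (M k). E \<subseteq> {\<omega>\<in>space (M k). Q k \<omega>} \<and> measure (M k) E \<ge> 1 - d / 2"
    using P Q by (simp_all add: whp_def)
  then show "\<forall>\<^sub>F k in sequentially. \<exists>E\<in>sets (M k). E \<subseteq> {\<omega>\<in>space (M k). P k \<omega> \<and> Q k \<omega>} \<and> measure (M k) E \<ge> 1 - d"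
  proof eventually_elim
    case (elim k)
    interpret prob_space "M k" by (rule prob)
    obtain E F where E: "E \<in> events" "E \<subseteq> {\<omega>\<in>space (M k). P k \<omega>}" "1 - d / 2 \<le> prob E"
      and F: "F \<in> events" "F \<subseteq> {\<omega>\<in>space (M k). Q k \<omega>}" "1 - d / 2 \<le> prob F"
      using elim by blast
    have "prob (space (M k) - (E \<inter> F)) \<le> prob (space (M k) - E) + prob (space (M k) - F)"
      using E(1) F(1) unfolding Diff_Int by (intro measure_Un_le) auto
    then have "1 - d \<le> prob (E \<inter> F)"
      using E F by (simp add: prob_compl)
    then show ?case using E F by (intro bexI[of _ "E \<inter> F"]) auto
  qed
qed

lemma whp_if_prob_compl_tendsto_0:
  assumes prob: "\<And>k. prob_space (M k)"
    and compl: "\<forall>\<^sub>F k in sequentially. {\<omega>\<in>space (M k). \<not> P k \<omega>} \<in> sets (M k) \<and>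
      measure (M k) {\<omega>\<in>space (M k). \<not> P k \<omega>} \<le> a k"
    and a: "a \<longlonglongrightarrow> 0"
  shows "whp M P"
  unfolding whp_def
proof (intro allI impI)
  fix d :: real assume "0 < d"
  then have "\<forall>\<^sub>F k in sequentially. a k < d" using a by (simp add: order_tendstoD)
  with compl show "\<forall>\<^sub>F k in sequentially. \<exists>E\<in>sets (M k). E \<subseteq> {\<omega>\<in>space (M k). P k \<omega>} \<and> measure (M k) E \<ge> 1 - d"
  proof eventually_elim
    case (elim k)
    interpret prob_space "M k" by (rule prob)
    let ?compl = "{\<omega>\<in>space (M k). \<not> P k \<omega>}"
    have "1 - d \<le> prob (space (M k) - ?compl)" using elim by (simp add: prob_compl)
    then show ?case using elim by (intro bexI[of _ "space (M k) - ?compl"]) auto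
  qed
qed

lemma bounded_in_prob_if_whp: "whp M (\<lambda>k \<omega>. \<bar>Z k \<omega>\<bar> \<le> C) \<Longrightarrow> bounded_in_prob M Z"
  unfolding whp_def bounded_in_prob_def by blast

lemma small_in_prob_if_whp_tendsto_0:
  assumes Z: "whp M (\<lambda>k \<omega>. \<bar>Z k \<omega>\<bar> \<le> r k)" and r: "r \<longlonglongrightarrow> 0"
  shows "small_in_prob M Z"
  unfolding small_in_prob_def
proof (intro allI impI)
  fix d :: real assume "0 < d"
  then have "\<forall>\<^sub>F k in sequentially. r k < d" using r by (simp add: order_tendstoD)
  then show "whp M (\<lambda>k \<omega>. \<bar>Z k \<omega>\<bar> \<le> d)"
    by (intro whp_mono[OF Z]) (auto elim!: eventually_mono)
qed

lemma const_mult_asymp_equiv_bounds: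
  fixes f g :: "nat \<Rightarrow> real"
  assumes "0 < c" and "\<And>k. f k = c * g k" and "\<forall>\<^sub>F k in sequentially. g k \<noteq> 0"
  shows "\<exists>c1 c2. 0 < c1 \<and> c1 \<le> c2 \<and> (\<forall>\<^sub>F k in sequentially. c1 \<le> f k / g k \<and> f k / g k \<le> c2)"
  using assms by (intro exI[of _ c]) (auto elim: eventually_mono)

section \<open>The debiased Lasso\<close>

locale debiased_lasso_asymptotics =
  fixes M :: "nat \<Rightarrow> 'a measure" and n p :: "nat \<Rightarrow> nat"
    and X :: "nat \<Rightarrow> 'a \<Rightarrow> nat \<Rightarrow> nat \<Rightarrow> real" and eps :: "nat \<Rightarrow> 'a \<Rightarrow> nat \<Rightarrow> real"
    and beta0 :: "nat \<Rightarrow> nat \<Rightarrow> real" and sigma Cmin Cmax kap :: real and K :: nat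
  assumes gaussian: "\<And>k. gaussian_noise (M k) matM (X k) (n k) (eps k) sigma"
    and n_lim: "filterlim n at_top sequentially"
    and p_gt_n: "\<And>k. n k < p k"
    and beta0_dim: "\<And>k j. p k \<le> j \<Longrightarrow> beta0 k j = 0"
    and Cmin_pos: "0 < Cmin" and K_pos: "0 < K" and K_dvd: "\<And>k. K dvd n k"
    and whp_phi_min: "whp M (\<lambda>k \<omega>. Cmin \<le> phi_min (n k) (p k) (X k \<omega>) (n k div K))"
    and Cmax_pos: "0 < Cmax" and whp_phi_max: "whp M (\<lambda>k \<omega>. phi_max (n k) (p k) (X k \<omega>) (n k) \<le> Cmax)"
    and kap_pos: "0 < kap"
    and whp_kappa_sq: "whp M (\<lambda>k \<omega>. kap \<le> kappa_sq (n k) (p k) (X k \<omega>) (l0norm (p k) (beta0 k)) 3)"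
    and sparsity: "(\<lambda>k. real (l0norm (p k) (beta0 k))) \<in> o(\<lambda>k. sqrt (real (n k) / ln (real (p k))))"
begin

abbreviation Y :: "nat \<Rightarrow> 'a \<Rightarrow> nat \<Rightarrow> real" where
  "Y k \<omega> \<equiv> \<lambda>i. mv (p k) (X k \<omega>) (beta0 k) i + eps k \<omega> i"

text \<open>The constant of \<open>lam0\<close> makes the Gaussian tail exponent \<open>2 ln p\<close>, enough for a union bound over
  \<open>p\<close> columns; that of \<open>lam1\<close> leaves fewer than \<open>n / K\<close> active coordinates in the node-wise Lasso.\<close>

definition lam0 :: "nat \<Rightarrow> real" where
  "lam0 k = 4 * sigma * sqrt Cmax * sqrt (ln (real (p k)) / real (n k))"

definition lam1 :: "nat \<Rightarrow> real" where
  "lam1 k = 2 * Cmax * sqrt (real K) * (1 / sqrt (real (n k)))"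

lemma prob_space_M: "prob_space (M k)"
  using gaussian by (rule gaussian_noise.axioms(1))

lemma sigma_pos: "0 < sigma"
  using gaussian by (rule gaussian_noise.sigma_pos)

lemma eventually_n_ge: "\<forall>\<^sub>F k in sequentially. N \<le> n k"
  using n_lim by (simp add: filterlim_at_top)

lemma p_pos: "0 < p k"
  using p_gt_n[of k] by simp

lemma ln_p_pos: "0 < n k \<Longrightarrow> 0 < ln (real (p k))"
  using p_gt_n[of k] by simp

lemma lam0_pos: "0 < n k \<Longrightarrow> 0 < lam0 k"
  using ln_p_pos sigma_pos Cmax_pos by (simp add: lam0_def)

lemma lam1_pos: "0 < n k \<Longrightarrow> 0 < lam1 k"
  using Cmax_pos K_pos by (simp add: lam1_def)

lemma lam0_asymp:
  "\<exists>c1 c2. 0 < c1 \<and> c1 \<le> c2 \<and> (\<forall>\<^sub>F k in sequentially.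
     c1 \<le> lam0 k / sqrt (ln (real (p k)) / real (n k)) \<and>
     lam0 k / sqrt (ln (real (p k)) / real (n k)) \<le> c2)"
proof (rule const_mult_asymp_equiv_bounds)
  show "\<forall>\<^sub>F k in sequentially. sqrt (ln (real (p k)) / real (n k)) \<noteq> 0"
    using eventually_n_ge[of 1]
  proof eventually_elim
    case (elim k)
    then show ?case using ln_p_pos[of k] by simp
  qed
  show "0 < 4 * sigma * sqrt Cmax" using sigma_pos Cmax_pos by simp
qed (rule lam0_def)

lemma lam1_asymp:
  "\<exists>c1 c2. 0 < c1 \<and> c1 \<le> c2 \<and> (\<forall>\<^sub>F k in sequentially.
     c1 \<le> lam1 k / (1 / sqrt (real (n k))) \<and> lam1 k / (1 / sqrt (real (n k))) \<le> c2)"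
proof (rule const_mult_asymp_equiv_bounds)
  show "\<forall>\<^sub>F k in sequentially. 1 / sqrt (real (n k)) \<noteq> 0"
    using eventually_n_ge[of 1] by eventually_elim simp
  show "0 < 2 * Cmax * sqrt (real K)" using Cmax_pos K_pos by simp
qed (rule lam1_def)

lemma lam0_union_bound:
  assumes nk: "0 < n k"
  shows "real (p k) * (2 * exp (- ((real (n k) * lam0 k / 2)^2) / (2 * (sigma^2 * (Cmax * real (n k))))))
    = 2 * inverse (real (p k))"
proof -
  have "(lam0 k)^2 = 16 * sigma^2 * Cmax * (ln (real (p k)) / real (n k))"
    using ln_p_pos[OF nk] Cmax_pos by (simp add: lam0_def power_mult_distrib)
  then have "(real (n k) * lam0 k / 2)^2 / (2 * (sigma^2 * (Cmax * real (n k)))) = 2 * ln (real (p k))"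
    using nk sigma_pos Cmax_pos by (simp add: power_divide power_mult_distrib field_simps power2_eq_square)
  then have "exp (- ((real (n k) * lam0 k / 2)^2) / (2 * (sigma^2 * (Cmax * real (n k))))) = inverse (real (p k))^2"
    using p_pos[of k] by (simp add: exp_minus exp_double power_inverse)
  then show ?thesis
    using p_pos[of k] by (simp add: power2_eq_square)
qed

lemma whp_noise_score_le_if_column_bounded:
  "whp M (\<lambda>k \<omega>. \<forall>j<p k. sqn (n k) (\<lambda>i. X k \<omega> i j) \<le> Cmax * real (n k) \<longrightarrow>
     \<bar>dotn (n k) (\<lambda>i. X k \<omega> i j) (eps k \<omega>) / real (n k)\<bar> \<le> lam0 k / 2)" (is "whp M ?P")
proof (rule whp_if_prob_compl_tendsto_0[OF prob_space_M])
  show "\<forall>\<^sub>F k in sequentially. {\<omega>\<in>space (M k). \<not> ?P k \<omega>} \<in> sets (M k) \<and>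
      measure (M k) {\<omega>\<in>space (M k). \<not> ?P k \<omega>} \<le> 2 * inverse (real (p k))"
    using eventually_n_ge[of 1]
  proof eventually_elim
    case (elim k)
    then have nk: "0 < n k" by simp
    interpret gaussian_noise "M k" matM "X k" "n k" "eps k" sigma by (rule gaussian)
    let ?t = "real (n k) * lam0 k / 2" and ?V = "Cmax * real (n k)"
    have exceeds: "\<not> \<bar>x / real (n k)\<bar> \<le> lam0 k / 2 \<longleftrightarrow> ?t < \<bar>x\<bar>" for x
      using nk by (simp add: not_le abs_divide field_simps)
    have compl: "{\<omega>\<in>space (M k). \<not> ?P k \<omega>} = {\<omega>\<in>space (M k). \<exists>j\<in>{..<p k}.
        sqn (n k) (\<lambda>i. X k \<omega> i j) \<le> ?V \<and> ?t < \<bar>dotn (n k) (\<lambda>i. X k \<omega> i j) (eps k \<omega>)\<bar>}"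
      by (simp only: not_all not_imp exceeds Bex_def lessThan_iff)
    have "0 \<le> ?t" "0 < ?V" using lam0_pos[OF nk] Cmax_pos nk by simp_all
    note union = dotn_design_noise_union_sets[of "{..<p k}" ?t ?V "\<lambda>j x i. x i j"]
      dotn_design_noise_union_bound[of "{..<p k}" ?t ?V "\<lambda>j x i. x i j"]
    show ?case
      unfolding compl using union[OF finite_lessThan \<open>0 \<le> ?t\<close> \<open>0 < ?V\<close> matM_entry_measurable]
      by (simp only: card_lessThan lam0_union_bound[OF nk])
  qed
  have "filterlim (\<lambda>k. real (p k)) at_top sequentially"
  proof (rule filterlim_at_top_mono)
    show "filterlim (\<lambda>k. real (n k)) at_top sequentially"
      using n_lim by (rule filterlim_compose[OF filterlim_real_sequentially])
  qed (use p_gt_n in \<open>auto intro: always_eventually less_imp_le\<close>)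
  then show "(\<lambda>k. 2 * inverse (real (p k))) \<longlonglongrightarrow> 0"
    by (intro tendsto_mult_right_zero tendsto_inverse_0_at_top)
qed

lemma whp_noise_score_le:
  "whp M (\<lambda>k \<omega>. \<forall>j<p k. \<bar>dotn (n k) (\<lambda>i. X k \<omega> i j) (eps k \<omega>) / real (n k)\<bar> \<le> lam0 k / 2)"
proof (rule whp_mono[OF whp_conj[OF prob_space_M whp_phi_max whp_noise_score_le_if_column_bounded]])
  have "sqn (n k) (\<lambda>i. X k \<omega> i j) \<le> Cmax * real (n k)"
    if "1 \<le> n k" "phi_max (n k) (p k) (X k \<omega>) (n k) \<le> Cmax" "j < p k" for k \<omega> j
    using order_trans[OF sqn_column_le_phi_max[OF that(3,1)] that(2)] that(1) by (simp add: field_simps)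
  then show "\<forall>\<^sub>F k in sequentially. \<forall>\<omega>\<in>space (M k). phi_max (n k) (p k) (X k \<omega>) (n k) \<le> Cmax \<and>
      (\<forall>j<p k. sqn (n k) (\<lambda>i. X k \<omega> i j) \<le> Cmax * real (n k) \<longrightarrow>
        \<bar>dotn (n k) (\<lambda>i. X k \<omega> i j) (eps k \<omega>) / real (n k)\<bar> \<le> lam0 k / 2) \<longrightarrow>
      (\<forall>j<p k. \<bar>dotn (n k) (\<lambda>i. X k \<omega> i j) (eps k \<omega>) / real (n k)\<bar> \<le> lam0 k / 2)"
    using eventually_n_ge[of 1] by (auto elim!: eventually_mono)
qed

lemma whp_lasso_l1_error:
  "whp M (\<lambda>k \<omega>. l1norm {..<p k} (\<lambda>j. lasso (n k) (p k) (X k \<omega>) (Y k \<omega>) (lam0 k) j - beta0 k j)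
     \<le> 6 * lam0 k * real (l0norm (p k) (beta0 k)) / kap)"
proof (rule whp_mono[OF whp_conj[OF prob_space_M whp_kappa_sq whp_noise_score_le]])
  have "l1norm {..<p k} (\<lambda>j. lasso (n k) (p k) (X k \<omega>) (Y k \<omega>) (lam0 k) j - beta0 k j)
      \<le> 6 * lam0 k * real (l0norm (p k) (beta0 k)) / kap"
    if "1 \<le> n k" and kappa: "kap \<le> kappa_sq (n k) (p k) (X k \<omega>) (l0norm (p k) (beta0 k)) 3"
      and noise: "\<forall>j<p k. \<bar>dotn (n k) (\<lambda>i. X k \<omega> i j) (eps k \<omega>) / real (n k)\<bar> \<le> lam0 k / 2" for k \<omega>
  proof (rule lasso_l1_error[where e = "eps k \<omega>"])
    show "0 < n k" "0 < lam0 k" using \<open>1 \<le> n k\<close> lam0_pos[of k] by simp_all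
    then show "l1_min (n k) {..<p k} (X k \<omega>) (Y k \<omega>) (lam0 k) (lasso (n k) (p k) (X k \<omega>) (Y k \<omega>) (lam0 k))"
      by (intro lasso_is_l1_min)
  qed (use beta0_dim kap_pos kappa noise in auto)
  then show "\<forall>\<^sub>F k in sequentially. \<forall>\<omega>\<in>space (M k).
      kap \<le> kappa_sq (n k) (p k) (X k \<omega>) (l0norm (p k) (beta0 k)) 3 \<and>
      (\<forall>j<p k. \<bar>dotn (n k) (\<lambda>i. X k \<omega> i j) (eps k \<omega>) / real (n k)\<bar> \<le> lam0 k / 2) \<longrightarrow>
      l1norm {..<p k} (\<lambda>j. lasso (n k) (p k) (X k \<omega>) (Y k \<omega>) (lam0 k) j - beta0 k j)
        \<le> 6 * lam0 k * real (l0norm (p k) (beta0 k)) / kap"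
    using eventually_n_ge[of 1] by (auto elim!: eventually_mono)
qed

lemma whp_tau_tilde_sq_ge: "whp M (\<lambda>k \<omega>. Cmin \<le> tau_tilde_sq (n k) (p k) (X k \<omega>) (lam1 k))"
proof (rule whp_mono[OF whp_conj[OF prob_space_M whp_phi_min whp_phi_max]])
  show "\<forall>\<^sub>F k in sequentially. \<forall>\<omega>\<in>space (M k). Cmin \<le> phi_min (n k) (p k) (X k \<omega>) (n k div K) \<and>
      phi_max (n k) (p k) (X k \<omega>) (n k) \<le> Cmax \<longrightarrow> Cmin \<le> tau_tilde_sq (n k) (p k) (X k \<omega>) (lam1 k)"
    using eventually_n_ge[of 1]
  proof eventually_elim
    case (elim k)
    then have nk: "0 < n k" by simp
    define m where "m = n k div K"
    have n_eq: "n k = K * m" using K_dvd by (simp add: m_def)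
    then have m: "0 < m" "m \<le> n k" using nk K_pos by auto
    have "real m * (lam1 k)^2 = 4 * Cmax^2"
      using m K_pos by (simp add: lam1_def n_eq power_mult_distrib power_divide)
    then have "Cmax^2 < real m * (lam1 k)^2" using Cmax_pos by simp
    then show ?case
      using tau_tilde_sq_ge_phi_min[OF nk p_pos lam1_pos[OF nk] m] Cmin_pos
      unfolding m_def by fastforce
  qed
qed

lemma Omega_hat_bounded_in_prob:
  "bounded_in_prob M (\<lambda>k \<omega>. Omega_hat (n k) (p k) (X k \<omega>) (lam1 k))"
proof (rule bounded_in_prob_if_whp, rule whp_mono[OF whp_tau_tilde_sq_ge])
  show "\<forall>\<^sub>F k in sequentially. \<forall>\<omega>\<in>space (M k). Cmin \<le> tau_tilde_sq (n k) (p k) (X k \<omega>) (lam1 k) \<longrightarrow>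
      \<bar>Omega_hat (n k) (p k) (X k \<omega>) (lam1 k)\<bar> \<le> 1 / Cmin"
    using eventually_n_ge[of 1]
  proof eventually_elim
    case (elim k)
    then have "0 \<le> lam1 k" using lam1_pos[of k] by simp
    then show ?case
      using Omega_hat_bounds[OF p_pos _ Cmin_pos] by auto
  qed
qed

lemma Delta1_small_in_prob:
  "small_in_prob M (\<lambda>k \<omega>. Delta1 (n k) (p k) (X k \<omega>) (Y k \<omega>) (beta0 k) (lam0 k) (lam1 k))"
proof (rule small_in_prob_if_whp_tendsto_0)
  let ?c = "2 * Cmax * sqrt (real K) / Cmin" and ?s = "\<lambda>k. real (l0norm (p k) (beta0 k))"
  have c: "0 \<le> ?c" using Cmax_pos Cmin_pos by simp
  show "whp M (\<lambda>k \<omega>. \<bar>Delta1 (n k) (p k) (X k \<omega>) (Y k \<omega>) (beta0 k) (lam0 k) (lam1 k)\<bar>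
      \<le> ?c * (6 * lam0 k * ?s k / kap))"
  proof (rule whp_mono[OF whp_conj[OF prob_space_M whp_tau_tilde_sq_ge whp_lasso_l1_error]])
    show "\<forall>\<^sub>F k in sequentially. \<forall>\<omega>\<in>space (M k).
      Cmin \<le> tau_tilde_sq (n k) (p k) (X k \<omega>) (lam1 k) \<and>
      l1norm {..<p k} (\<lambda>j. lasso (n k) (p k) (X k \<omega>) (Y k \<omega>) (lam0 k) j - beta0 k j)
        \<le> 6 * lam0 k * ?s k / kap \<longrightarrow>
      \<bar>Delta1 (n k) (p k) (X k \<omega>) (Y k \<omega>) (beta0 k) (lam0 k) (lam1 k)\<bar> \<le> ?c * (6 * lam0 k * ?s k / kap)"
      using eventually_n_ge[of 1]
    proof eventually_elim
      case (elim k)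
      then have nk: "0 < n k" by simp
      then have c_eq: "sqrt (real (n k)) * lam1 k / Cmin = ?c" by (simp add: lam1_def)
      show ?case
      proof (intro ballI impI, elim conjE)
        fix \<omega>
        let ?err = "l1norm {..<p k} (\<lambda>j. lasso (n k) (p k) (X k \<omega>) (Y k \<omega>) (lam0 k) j - beta0 k j)"
        assume tau: "Cmin \<le> tau_tilde_sq (n k) (p k) (X k \<omega>) (lam1 k)" and err: "?err \<le> 6 * lam0 k * ?s k / kap"
        have "\<bar>Delta1 (n k) (p k) (X k \<omega>) (Y k \<omega>) (beta0 k) (lam0 k) (lam1 k)\<bar> \<le> ?c * ?err"
          using abs_Delta1_le[OF lam1_pos[OF nk] Cmin_pos tau] unfolding c_eq .
        also have "\<dots> \<le> ?c * (6 * lam0 k * ?s k / kap)"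
          using err c by (rule mult_left_mono)
        finally show "\<bar>Delta1 (n k) (p k) (X k \<omega>) (Y k \<omega>) (beta0 k) (lam0 k) (lam1 k)\<bar>
            \<le> ?c * (6 * lam0 k * ?s k / kap)" .
      qed
    qed
  qed
  have "(\<lambda>k. ?c * (6 * (4 * sigma * sqrt Cmax) / kap) * (?s k / sqrt (real (n k) / ln (real (p k))))) \<longlonglongrightarrow> 0"
    using smalloD_tendsto[OF sparsity] by (rule tendsto_mult_right_zero)
  then show "(\<lambda>k. ?c * (6 * lam0 k * ?s k / kap)) \<longlonglongrightarrow> 0"
    by (simp add: lam0_def real_sqrt_divide mult_ac)
qed

lemma W1_conditional_law:
  assumes A: "A \<in> sets borel" and B: "B \<in> sets matM"
  shows "measure (completion (M k))
      {\<omega>\<in>space (M k). X k \<omega> \<in> B \<and> W1 (n k) (p k) (X k \<omega>) (eps k \<omega>) (lam1 k) \<in> A}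
    = (\<integral>\<omega>. indicator B (X k \<omega>) * measure (normal_law (sigma^2 * Omega_hat (n k) (p k) (X k \<omega>) (lam1 k))) A
       \<partial>completion (M k))"
proof -
  interpret gaussian_noise "M k" matM "X k" "n k" "eps k" sigma by (rule gaussian)
  define u where "u x i = mv (p k) x (Theta_hat (n k) (p k) x (lam1 k)) i / sqrt (real (n k))" for x i
  have u: "(\<lambda>x. u x i) \<in> borel_measurable matM" if "i < n k" for i
    unfolding u_def using that lam1_pos[of k] p_pos
    by (intro borel_measurable_divide mv_Theta_hat_measurable borel_measurable_const) auto
  have W: "W1 (n k) (p k) (X k \<omega>) (eps k \<omega>) (lam1 k) = dotn (n k) (u (X k \<omega>)) (eps k \<omega>)" for \<omega>
    by (simp add: W1_eq_dotn dotn_def u_def sum_divide_distrib)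
  have Omega: "Omega_hat (n k) (p k) x (lam1 k) = sqn (n k) (u x)" for x
    by (simp add: Omega_hat_eq_sqn_mv sqn_def u_def power_divide sum_divide_distrib)
  note [measurable] = design_measurable dotn_design_noise_measurable[OF u] A B
  have "{\<omega>\<in>space (M k). X k \<omega> \<in> B \<and> dotn (n k) (u (X k \<omega>)) (eps k \<omega>) \<in> A} \<in> sets (M k)"
    by measurable
  moreover have "(\<lambda>\<omega>. indicator B (X k \<omega>) * measure (normal_law (sigma^2 * sqn (n k) (u (X k \<omega>)))) A)
      \<in> borel_measurable (M k)"
    by (rule measurable_compose[OF design_measurable normal_law_design_measurable[OF u A B]])
  ultimately show ?thesis
    unfolding W Omega using prob_dotn_design_noise[OF u A B] by (simp add: integral_completion)
qed

end

theorem theorem1: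
  fixes M :: "nat \<Rightarrow> 'a measure"
    and n p :: "nat \<Rightarrow> nat"
    and X :: "nat \<Rightarrow> 'a \<Rightarrow> nat \<Rightarrow> nat \<Rightarrow> real"
    and eps :: "nat \<Rightarrow> 'a \<Rightarrow> nat \<Rightarrow> real"
    and beta0 :: "nat \<Rightarrow> nat \<Rightarrow> real"
    and sigma :: real
  defines "Y \<equiv> (\<lambda>k \<omega> i. mv (p k) (X k \<omega>) (beta0 k) i + eps k \<omega> i)"
    and "s0 \<equiv> (\<lambda>k. l0norm (p k) (beta0 k))"
  assumes prob: "\<And>k. prob_space (M k)"
    and n_lim: "filterlim n at_top sequentially"
    and p_gt_n: "\<And>k. n k < p k"
    and X_dims: "\<And>k \<omega> i j. n k \<le> i \<or> p k \<le> j \<Longrightarrow> X k \<omega> i j = 0"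
    and X_mean0: "\<And>k i j. i < n k \<Longrightarrow> j < p k \<Longrightarrow>
        integrable (M k) (\<lambda>\<omega>. X k \<omega> i j) \<and> (\<integral>\<omega>. X k \<omega> i j \<partial>M k) = 0"
    and X_second: "\<And>k i j l. i < n k \<Longrightarrow> j < p k \<Longrightarrow> l < p k \<Longrightarrow>
        integrable (M k) (\<lambda>\<omega>. X k \<omega> i j * X k \<omega> i l)"
    and Sigma_pd: "\<And>k v. (\<forall>j\<ge>p k. v j = 0) \<Longrightarrow> (\<exists>j<p k. v j \<noteq> 0) \<Longrightarrow>
        0 < (\<Sum>j<p k. \<Sum>l<p k. v j *
               ((\<Sum>i<n k. \<integral>\<omega>. X k \<omega> i j * X k \<omega> i l \<partial>M k) / real (n k)) * v l)"
    and beta0_dim: "\<And>k j. p k \<le> j \<Longrightarrow> beta0 k j = 0"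
    and sigma_pos: "sigma > 0"
    and noise: "\<And>k. distributed (M k) (PiM {..<n k} (\<lambda>_. lborel))
        (\<lambda>\<omega>. restrict (eps k \<omega>) {..<n k}) (\<lambda>x. ennreal (\<Prod>i<n k. normal_density 0 sigma (x i)))"
    and X_meas: "\<And>k. X k \<in> measurable (M k) matM"
    and indep: "\<And>k. prob_space.indep_set (M k)
        {X k -` Bx \<inter> space (M k) | Bx. Bx \<in> sets matM}
        {(\<lambda>\<omega>. restrict (eps k \<omega>) {..<n k}) -` Ee \<inter> space (M k) | Ee.
           Ee \<in> sets (PiM {..<n k} (\<lambda>_. (borel :: real measure)))}"
    and A1: "\<And>k. AE \<omega> in M k. general_position (n k) (p k) (X k \<omega>)"
    and A2: "\<exists>Cmin K. Cmin > 0 \<and> K > 0 \<and> (\<forall>k. K dvd n k) \<and>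
        whp M (\<lambda>k \<omega>. phi_min (n k) (p k) (X k \<omega>) (n k div K) \<ge> Cmin)"
    and A3: "\<exists>Cmax > 0. whp M (\<lambda>k \<omega>. phi_max (n k) (p k) (X k \<omega>) (n k) \<le> Cmax)"
    and A4i: "\<exists>Cstar > 0. \<exists>B. \<forall>\<^sub>F k in sequentially. \<exists>E\<in>sets (M k).
        E \<subseteq> {\<omega>\<in>space (M k). phi_max (n k) (p k) (X k \<omega>) 1 \<le> Cstar} \<and>
        measure (M k) E \<ge> 1 - B / real (p k)"
    and A4ii: "\<exists>kmin > 0. whp M (\<lambda>k \<omega>. kappa_sq (n k) (p k) (X k \<omega>) (s0 k) 3 \<ge> kmin^2)"
    and sparsity: "(\<lambda>k. real (s0 k)) \<in> o(\<lambda>k. sqrt (real (n k) / ln (real (p k))))"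
  shows "\<exists>lam0 lam1 :: nat \<Rightarrow> real.
     (\<exists>c1 c2. 0 < c1 \<and> c1 \<le> c2 \<and> (\<forall>\<^sub>F k in sequentially.
        c1 \<le> lam0 k / sqrt (ln (real (p k)) / real (n k)) \<and>
        lam0 k / sqrt (ln (real (p k)) / real (n k)) \<le> c2)) \<and>
     (\<exists>c1 c2. 0 < c1 \<and> c1 \<le> c2 \<and> (\<forall>\<^sub>F k in sequentially.
        c1 \<le> lam1 k / (1 / sqrt (real (n k))) \<and> lam1 k / (1 / sqrt (real (n k))) \<le> c2)) \<and>
     (\<forall>k. \<forall>\<omega>\<in>space (M k).
        sqrt (real (n k)) * (debiased1 (n k) (p k) (X k \<omega>) (Y k \<omega>) (lam0 k) (lam1 k) - beta0 k 0)
        = W1 (n k) (p k) (X k \<omega>) (eps k \<omega>) (lam1 k)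
          + Delta1 (n k) (p k) (X k \<omega>) (Y k \<omega>) (beta0 k) (lam0 k) (lam1 k)) \<and>
     (\<forall>k. \<forall>A\<in>sets (borel :: real measure). \<forall>Bx\<in>sets matM.
        measure (completion (M k))
          {\<omega>\<in>space (M k). X k \<omega> \<in> Bx \<and> W1 (n k) (p k) (X k \<omega>) (eps k \<omega>) (lam1 k) \<in> A}
        = (\<integral>\<omega>. indicator Bx (X k \<omega>) *
             measure (normal_law (sigma^2 * Omega_hat (n k) (p k) (X k \<omega>) (lam1 k))) A
           \<partial>completion (M k))) \<and>
     bounded_in_prob M (\<lambda>k \<omega>. Omega_hat (n k) (p k) (X k \<omega>) (lam1 k)) \<and>
     small_in_prob M (\<lambda>k \<omega>. Delta1 (n k) (p k) (X k \<omega>) (Y k \<omega>) (beta0 k) (lam0 k) (lam1 k))"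
proof -
  obtain Cmin K where Cmin: "0 < Cmin" and K: "0 < K" "\<And>k. K dvd n k"
    and phi_min: "whp M (\<lambda>k \<omega>. phi_min (n k) (p k) (X k \<omega>) (n k div K) \<ge> Cmin)"
    using A2 by blast
  obtain Cmax where Cmax: "0 < Cmax" and phi_max: "whp M (\<lambda>k \<omega>. phi_max (n k) (p k) (X k \<omega>) (n k) \<le> Cmax)"
    using A3 by blast
  obtain kmin where kmin: "0 < kmin" and kappa: "whp M (\<lambda>k \<omega>. kappa_sq (n k) (p k) (X k \<omega>) (s0 k) 3 \<ge> kmin^2)"
    using A4ii by blast
  interpret debiased_lasso_asymptotics M n p X eps beta0 sigma Cmin Cmax "kmin^2" K
  proof (rule debiased_lasso_asymptotics.intro)
    show "gaussian_noise (M k) matM (X k) (n k) (eps k) sigma" for k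
      by (intro gaussian_noiseI prob sigma_pos X_meas noise indep)
  qed (use n_lim p_gt_n beta0_dim Cmin K phi_min Cmax phi_max kmin kappa sparsity in \<open>simp_all add: s0_def\<close>)
  show ?thesis
    unfolding Y_def
    by (intro exI[of _ lam0] exI[of _ lam1] conjI allI ballI lam0_asymp lam1_asymp
        debiased1_decomposition p_pos W1_conditional_law Omega_hat_bounded_in_prob Delta1_small_in_prob)
      simp_all
qed

end
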